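(* Let $\mathsf Z$ be any central charge. Then $\bar A_{\mathsf Z}=F_{\mathsf Z}*\bar A_*$, or equivalently, for all $\gamma\in S$, $$\bar A_{\mathsf Z}(\gamma)=\sum_{n\ge1}\ \sum_{\alpha\in S^n,\ \alpha_1+\dots+\alpha_n=\gamma}F_{\mathsf Z}(\alpha)\cdot\prod_{i=1}^n\bar A_*(\alpha_i)$$ (product taken in the order $i=1,\dots,n$), where $F_{\mathsf Z}:S^*\to\mathbb Q$ is the collection such that $F_{\mathsf Z}(\alpha)=1$ for $\alpha\in S$ and, for $\alpha\in S^n$ with $n\ge2$, $$F_{\mathsf Z}(\alpha)=\sum_T\Big[(-1)^{|V(T)|-1}\big(g_{\mathsf Z}(\alpha|_{\mathrm{ch}(v_0)})-g_*(\alpha|_{\mathrm{ch}(v_0)})\big)\prod_{v\in V(T)\setminus\{v_0\}}g_*(\alpha|_{\mathrm{ch}(v)})\Big],$$ the sum running over plane rooted trees $T$ with leaves $1,\dots,n$ (in this order) all of whose internal vertices have at least two children, and $v_0$ denoting the root of $T$.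
   Context: Setting. $S=\mathbb N^r\setminus\{0\}$, $\Gamma=\mathbb Z^r$, $S^*=\bigsqcup_{n\ge1}S^n$. $\mathcal R=\bigoplus_{\gamma\in\mathbb N^r}\mathcal R_\gamma$ is a graded associative (not necessarily commutative) $\mathbb Q$-algebra, and $\Gamma$ carries a skew-symmetric bilinear form $\langle-,-\rangle:\Gamma\times\Gamma\to\mathbb Z$ such that $\langle\gamma,\gamma'\rangle=0$ implies $[\mathcal R_\gamma,\mathcal R_{\gamma'}]=0$. Fix an arbitrary map $A:S\to\mathcal R$ with $A(\gamma)\in\mathcal R_\gamma$. A collection is a map $F:S^*\to\mathbb Q$. It acts on maps $H:S\to\mathcal R$ with $H(\gamma)\in\mathcal R_\gamma$ by $(F*H)(\gamma)=\sum_{n\ge1}\sum_{\alpha\in S^n,\,\alpha_1+\dots+\alpha_n=\gamma}F(\alpha)H(\alpha_1)\cdots H(\alpha_n)$. Central charges. A central charge is a linear map $\mathsf Z=-\theta+\mathbf i\rho:\mathbb Z^r\to\mathbb C$ with $\theta,\rho\in\mathrm{Hom}(\mathbb Z^r,\mathbb R)\cong\mathbb R^r$ and $\rho_k>0$ for all $k$. For $a\in S$ put $\mu_{\mathsf Z}(a)=\theta(a)/\rho(a)$; write $a\le_{\mathsf Z}b$ if $\mu_{\mathsf Z}(a)\le\mu_{\mathsf Z}(b)$, and $>_{\mathsf Z},\ge_{\mathsf Z},\sim_{\mathsf Z}$ for the corresponding strict inequality, reversed inequality and equality of slopes. For $\theta\in\mathbb R^r$ alone, the subscript $\theta$ means that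 one uses $\mathsf Z=-\theta+\mathbf i\rho$ with $\rho=(1,\dots,1)$. $\mathsf Z$ is generic if $a\sim_{\mathsf Z}b$ (for $a,b\in S$) implies that $a,b$ are proportional. Invariants. The family $A_{\mathsf Z}(\gamma)\in\mathcal R_\gamma$, $\gamma\in S$, is determined recursively by $A(\gamma)=\sum_{\alpha_1+\dots+\alpha_n=\gamma,\ \alpha_1>_{\mathsf Z}\dots>_{\mathsf Z}\alpha_n}A_{\mathsf Z}(\alpha_1)\cdots A_{\mathsf Z}(\alpha_n)$ for all $\gamma\in S$. Then $\bar A_{\mathsf Z}=\mathbf{log}_{\mathsf Z}*A_{\mathsf Z}$, where $\mathbf{log}_{\mathsf Z}(\alpha)=\frac{(-1)^{n-1}}n$ if $\alpha\in S^n$ satisfies $\alpha_1\sim_{\mathsf Z}\dots\sim_{\mathsf Z}\alpha_n$, and $0$ otherwise. The attractor invariants are $\bar A_*(\gamma)=\bar A_{\theta'}(\gamma)$, where $\theta'$ is a generic perturbation of $\theta=\langle-,\gamma\rangle$, i.e. a generic stability parameter $\theta'\in\mathbb R^r$ sufficiently close to $\theta$ (how close depends on $\gamma$; the value does not depend on the choice). Collections $g_{\mathsf Z}$ and $g_*$. For $\alpha\in S^n$ and $1\le k<n$ put $\alpha_{\le k}=\alpha_1+\dots+\alpha_k$, $\alpha_{>k}=\alpha_{k+1}+\dots+\alpha_n$. Then $g_{\mathsf Z}(\alpha)=\frac{(-1)^{n-1}}{n_0+1}$ if $\alpha_{\le k}\ge_{\mathsf Z}\alpha_{>k}$ for all $1\le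 k<n$, and $0$ otherwise, where $n_0$ is the number of $1\le k<n$ with $\alpha_{\le k}\sim_{\mathsf Z}\alpha_{>k}$. Similarly $g_*(\alpha)=\frac{(-1)^{n-1}}{n_0+1}$ if $\langle\alpha_{\le k},\alpha_{>k}\rangle\ge0$ for all $1\le k<n$, and $0$ otherwise, where now $n_0$ is the number of $1\le k<n$ with $\langle\alpha_{\le k},\alpha_{>k}\rangle=0$. Trees. In a plane rooted tree the children of each internal vertex are linearly ordered, which induces a linear order on the leaves; trees are taken up to isomorphism and the leaves are identified with $1<\dots<n$ in this order. $V(T)$ is the set of internal (non-leaf) vertices, including the root; $\mathrm{ch}(v)$ is the ordered set of children of $v$. For a vertex or leaf $u$ put $\alpha_u=\sum_i\alpha_i$, summed over the leaves $i$ that are descendants of (or equal to) $u$, and $\alpha|_{\mathrm{ch}(v)}=(\alpha_u)_{u\in\mathrm{ch}(v)}$, viewed as an element of $S^*$. *)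

theory Defs
  imports "HOL-Analysis.Analysis"
begin

definition dimvecs :: "(nat ^ 'r::finite) set" where
  "dimvecs = UNIV - {0}"

definition to_int_vec :: "nat ^ 'r::finite \<Rightarrow> int ^ 'r" where
  "to_int_vec a = (\<chi> i. int (a $ i))"

text \<open>Tuples \<open>(\<alpha>\<^sub>1, \<dots>, \<alpha>\<^sub>n) \<in> S\<^sup>n\<close> with \<open>n \<ge> 1\<close> are represented as nonempty lists.\<close>

definition decomps :: "nat ^ 'r::finite \<Rightarrow> (nat ^ 'r) list set" where
  "decomps \<gamma> = {\<alpha>. \<alpha> \<noteq> [] \<and> set \<alpha> \<subseteq> dimvecs \<and> sum_list \<alpha> = \<gamma>}"

definition vtotal :: "nat ^ 'r::finite \<Rightarrow> nat" where
  "vtotal a = (\<Sum>i\<in>UNIV. a $ i)"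

lemma vtotal_add [simp]: "vtotal (a + b) = vtotal a + vtotal b"
  by (simp add: vtotal_def sum.distrib)

lemma vtotal_zero [simp]: "vtotal 0 = 0"
  by (simp add: vtotal_def)

lemma vtotal_pos: "a \<in> dimvecs \<Longrightarrow> vtotal a > 0"
  by (auto simp: dimvecs_def vtotal_def vec_eq_iff intro!: sum_pos2)

lemma length_le_vtotal: "set \<alpha> \<subseteq> dimvecs \<Longrightarrow> length \<alpha> \<le> vtotal (sum_list \<alpha>)"
  by (induction \<alpha>) (auto dest: vtotal_pos)

lemma finite_vtotal_le: "finite {a :: nat ^ 'r::finite. vtotal a \<le> n}"
proof (rule finite_subset)
  show "{a :: nat ^ 'r. vtotal a \<le> n} \<subseteq> vec_lambda ` (UNIV \<rightarrow>\<^sub>E {..n})"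
  proof
    fix a :: "nat ^ 'r" assume a: "a \<in> {a. vtotal a \<le> n}"
    have "a $ i \<le> n" for i
    proof -
      have "a $ i \<le> vtotal a"
        unfolding vtotal_def by (rule member_le_sum) auto
      with a show ?thesis by simp
    qed
    then have "vec_nth a \<in> UNIV \<rightarrow>\<^sub>E {..n}" by auto
    then show "a \<in> vec_lambda ` (UNIV \<rightarrow>\<^sub>E {..n})"
      by (metis image_eqI vec_nth_inverse)
  qed
  show "finite (vec_lambda ` (UNIV \<rightarrow>\<^sub>E {..n}) :: (nat ^ 'r) set)"
    by (intro finite_imageI finite_PiE) auto
qed

lemma vtotal_member_le: "a \<in> set \<alpha> \<Longrightarrow> vtotal a \<le> vtotal (sum_list \<alpha>)"
  by (induction \<alpha>) auto

lemma vtotal_member_less: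
  assumes "\<alpha> \<in> decomps \<gamma>" "length \<alpha> \<ge> 2" "a \<in> set \<alpha>"
  shows "vtotal a < vtotal \<gamma>"
proof -
  obtain xs ys where \<alpha>: "\<alpha> = xs @ a # ys" using assms(3) by (meson split_list)
  have "length (xs @ ys) \<ge> 1" using assms(2) \<alpha> by simp
  moreover have "length (xs @ ys) \<le> vtotal (sum_list (xs @ ys))"
    by (rule length_le_vtotal) (use assms(1) \<alpha> in \<open>auto simp: decomps_def\<close>)
  ultimately show ?thesis using assms(1) \<alpha> by (auto simp: decomps_def)
qed

lemma finite_decomps: "finite (decomps \<gamma>)"
proof (rule finite_subset)
  show "decomps \<gamma> \<subseteq> {\<alpha>. set \<alpha> \<subseteq> {a. vtotal a \<le> vtotal \<gamma>} \<and> length \<alpha> \<le> vtotal \<gamma>}"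
    using length_le_vtotal vtotal_member_le by (fastforce simp: decomps_def)
  show "finite {\<alpha> :: (nat ^ 'r::finite) list. set \<alpha> \<subseteq> {a. vtotal a \<le> vtotal \<gamma>} \<and> length \<alpha> \<le> vtotal \<gamma>}"
    by (intro finite_lists_length_le finite_vtotal_le)
qed

text \<open>Algebras are not required to have a unit (no unit is used anywhere below), so that the
  ordered product is only meaningful for nonempty lists.\<close>

fun ordered_prod :: "'a::ring list \<Rightarrow> 'a" where
  "ordered_prod [] = 0"
| "ordered_prod [x] = x"
| "ordered_prod (x # y # zs) = x * ordered_prod (y # zs)"

locale graded_rat_algebra = vector_space smul
  for smul :: "rat \<Rightarrow> 'a::ring \<Rightarrow> 'a" +
  fixes R :: "nat ^ 'r::finite \<Rightarrow> 'a set"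
  assumes smul_mult_left: "smul q x * y = smul q (x * y)"
    and smul_mult_right: "x * smul q y = smul q (x * y)"
    and subspace_component: "subspace (R \<gamma>)"
    and direct_sum: "\<exists>!c. (\<forall>\<gamma>. c \<gamma> \<in> R \<gamma>) \<and> finite {\<gamma>. c \<gamma> \<noteq> 0} \<and> x = (\<Sum>\<gamma> | c \<gamma> \<noteq> 0. c \<gamma>)"
    and graded_mult: "x \<in> R \<gamma> \<Longrightarrow> y \<in> R \<gamma>' \<Longrightarrow> x * y \<in> R (\<gamma> + \<gamma>')"

definition skew_bilinear_form :: "(int ^ 'r::finite \<Rightarrow> int ^ 'r \<Rightarrow> int) \<Rightarrow> bool" where
  "skew_bilinear_form B \<longleftrightarrow>
     (\<forall>x y z. B (x + y) z = B x z + B y z) \<and>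
     (\<forall>x y z. B x (y + z) = B x y + B x z) \<and>
     (\<forall>x y. B x y = - B y x)"

definition act ::
  "(rat \<Rightarrow> 'a::ring \<Rightarrow> 'a) \<Rightarrow> ((nat ^ 'r::finite) list \<Rightarrow> rat) \<Rightarrow> (nat ^ 'r \<Rightarrow> 'a) \<Rightarrow> nat ^ 'r \<Rightarrow> 'a" where
  "act smul F H \<gamma> = (\<Sum>\<alpha>\<in>decomps \<gamma>. smul (F \<alpha>) (ordered_prod (map H \<alpha>)))"

text \<open>\<open>Z = -\<theta> + \<i>\<rho>\<close>, that is, \<open>\<theta> = - Re \<circ> Z\<close> and \<open>\<rho> = Im \<circ> Z\<close>.\<close>

definition central_charge :: "(int ^ 'r::finite \<Rightarrow> complex) \<Rightarrow> bool" where
  "central_charge Z \<longleftrightarrow> (\<forall>x y. Z (x + y) = Z x + Z y) \<and> (\<forall>k. Im (Z (axis k 1)) > 0)"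

definition slope :: "(int ^ 'r::finite \<Rightarrow> complex) \<Rightarrow> nat ^ 'r \<Rightarrow> real" where
  "slope Z a = - Re (Z (to_int_vec a)) / Im (Z (to_int_vec a))"

definition charge_of :: "real ^ 'r::finite \<Rightarrow> int ^ 'r \<Rightarrow> complex" where
  "charge_of \<theta> x = Complex (- (\<Sum>k\<in>UNIV. \<theta> $ k * of_int (x $ k))) (\<Sum>k\<in>UNIV. of_int (x $ k))"

definition proportional :: "nat ^ 'r::finite \<Rightarrow> nat ^ 'r \<Rightarrow> bool" where
  "proportional a b \<longleftrightarrow> (\<exists>c::rat. \<forall>k. of_nat (a $ k) = c * of_nat (b $ k))"

definition generic :: "(int ^ 'r::finite \<Rightarrow> complex) \<Rightarrow> bool" where
  "generic Z \<longleftrightarrow> (\<forall>a\<in>dimvecs. \<forall>b\<in>dimvecs. slope Z a = slope Z b \<longrightarrow> proportional a b)"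

definition slope_decreasing :: "(int ^ 'r::finite \<Rightarrow> complex) \<Rightarrow> (nat ^ 'r) list \<Rightarrow> bool" where
  "slope_decreasing Z \<alpha> \<longleftrightarrow> successively (\<lambda>a b. slope Z a > slope Z b) \<alpha>"

text \<open>The invariants \<open>A\<^sub>Z\<close>, with their defining recursion solved for the term with \<open>n = 1\<close>;
  the original form of the recursion is lemma \<open>hn_recursion\<close> below.\<close>

function hn_inv ::
  "(int ^ 'r::finite \<Rightarrow> complex) \<Rightarrow> (nat ^ 'r \<Rightarrow> 'a::ring) \<Rightarrow> nat ^ 'r \<Rightarrow> 'a" where
  "hn_inv Z A \<gamma> = A \<gamma> -
     (\<Sum>\<alpha>\<in>{\<alpha> \<in> decomps \<gamma>. length \<alpha> \<ge> 2 \<and> slope_decreasing Z \<alpha>}.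
        ordered_prod (map (\<lambda>a. hn_inv Z A a) \<alpha>))"
  by pat_completeness auto
termination
  by (relation "Wellfounded.measure (\<lambda>(Z, A, \<gamma>). vtotal \<gamma>)") (auto intro: vtotal_member_less)

declare hn_inv.simps [simp del]

lemma hn_recursion_split:
  fixes G :: "nat ^ 'r::finite \<Rightarrow> 'a::ring"
  assumes "\<gamma> \<in> dimvecs"
  shows "(\<Sum>\<alpha>\<in>{\<alpha> \<in> decomps \<gamma>. slope_decreasing Z \<alpha>}. ordered_prod (map G \<alpha>)) =
    G \<gamma> + (\<Sum>\<alpha>\<in>{\<alpha> \<in> decomps \<gamma>. length \<alpha> \<ge> 2 \<and> slope_decreasing Z \<alpha>}. ordered_prod (map G \<alpha>))"
proof -
  have eq: "{\<alpha> \<in> decomps \<gamma>. slope_decreasing Z \<alpha>} =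
      insert [\<gamma>] {\<alpha> \<in> decomps \<gamma>. length \<alpha> \<ge> 2 \<and> slope_decreasing Z \<alpha>}" (is "?L = ?R")
  proof (intro equalityI subsetI)
    fix \<alpha> assume \<alpha>: "\<alpha> \<in> ?L"
    then have "\<alpha> \<noteq> []" by (auto simp: decomps_def)
    then consider a where "\<alpha> = [a]" | "length \<alpha> \<ge> 2"
      by (cases \<alpha> rule: remdups_adj.cases) auto
    then show "\<alpha> \<in> ?R" using \<alpha> by cases (auto simp: decomps_def)
  next
    fix \<alpha> assume "\<alpha> \<in> ?R"
    then show "\<alpha> \<in> ?L" using assms by (auto simp: decomps_def slope_decreasing_def)
  qed
  have "finite {\<alpha> \<in> decomps \<gamma>. length \<alpha> \<ge> 2 \<and> slope_decreasing Z \<alpha>}"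
    by (rule finite_subset[OF _ finite_decomps[of \<gamma>]]) auto
  then show ?thesis by (simp add: eq)
qed

lemma hn_recursion:
  assumes "\<gamma> \<in> dimvecs"
  shows "A \<gamma> = (\<Sum>\<alpha>\<in>{\<alpha> \<in> decomps \<gamma>. slope_decreasing Z \<alpha>}. ordered_prod (map (hn_inv Z A) \<alpha>))"
  unfolding hn_recursion_split[OF assms] by (subst (1) hn_inv.simps) simp

lemma hn_inv_unique:
  assumes "\<And>\<gamma>. \<gamma> \<in> dimvecs \<Longrightarrow>
      A \<gamma> = (\<Sum>\<alpha>\<in>{\<alpha> \<in> decomps \<gamma>. slope_decreasing Z \<alpha>}. ordered_prod (map G \<alpha>))"
    and "\<gamma> \<in> dimvecs"
  shows "G \<gamma> = hn_inv Z A \<gamma>"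
  using assms(2)
proof (induction "vtotal \<gamma>" arbitrary: \<gamma> rule: less_induct)
  case less
  have "map G \<alpha> = map (hn_inv Z A) \<alpha>" if "\<alpha> \<in> decomps \<gamma>" "length \<alpha> \<ge> 2" for \<alpha>
    using less.hyps vtotal_member_less[OF that] that(1) by (auto simp: decomps_def)
  then have "(\<Sum>\<alpha>\<in>{\<alpha> \<in> decomps \<gamma>. length \<alpha> \<ge> 2 \<and> slope_decreasing Z \<alpha>}. ordered_prod (map G \<alpha>)) =
      (\<Sum>\<alpha>\<in>{\<alpha> \<in> decomps \<gamma>. length \<alpha> \<ge> 2 \<and> slope_decreasing Z \<alpha>}. ordered_prod (map (hn_inv Z A) \<alpha>))"
    by (intro sum.cong refl arg_cong[where f = ordered_prod]) blast
  then show ?case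
    using assms(1)[OF less.prems] hn_recursion_split[OF less.prems, where Z = Z and G = G]
    by (subst hn_inv.simps) simp
qed

definition log_coll :: "(int ^ 'r::finite \<Rightarrow> complex) \<Rightarrow> (nat ^ 'r) list \<Rightarrow> rat" where
  "log_coll Z \<alpha> =
     (if successively (\<lambda>a b. slope Z a = slope Z b) \<alpha>
      then (-1) ^ (length \<alpha> - 1) / of_nat (length \<alpha>) else 0)"

definition inv_bar ::
  "(rat \<Rightarrow> 'a::ring \<Rightarrow> 'a) \<Rightarrow> (nat ^ 'r::finite \<Rightarrow> 'a) \<Rightarrow> (int ^ 'r \<Rightarrow> complex) \<Rightarrow> nat ^ 'r \<Rightarrow> 'a" where
  "inv_bar smul A Z = act smul (log_coll Z) (hn_inv Z A)"

definition attractor_stability ::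
  "(int ^ 'r::finite \<Rightarrow> int ^ 'r \<Rightarrow> int) \<Rightarrow> nat ^ 'r \<Rightarrow> real ^ 'r" where
  "attractor_stability B \<gamma> = (\<chi> k. of_int (B (axis k 1) (to_int_vec \<gamma>)))"

text \<open>The attractor invariant of \<open>\<gamma>\<close> is the common value of \<open>inv_bar\<close> at \<open>\<gamma>\<close> for all generic
  \<open>\<theta>'\<close> in a sufficiently small neighbourhood (depending on \<open>\<gamma>\<close>) of \<open>\<langle>-, \<gamma>\<rangle>\<close>.
  That such a value exists and is unique is part of what has to be shown about it.\<close>

definition attractor_inv ::
  "(rat \<Rightarrow> 'a::ring \<Rightarrow> 'a) \<Rightarrow> (int ^ 'r::finite \<Rightarrow> int ^ 'r \<Rightarrow> int) \<Rightarrow> (nat ^ 'r \<Rightarrow> 'a) \<Rightarrow> nat ^ 'r \<Rightarrow> 'a" where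
  "attractor_inv smul B A \<gamma> =
     (THE x. \<forall>\<^sub>F \<theta>' in nhds (attractor_stability B \<gamma>).
        generic (charge_of \<theta>') \<longrightarrow> inv_bar smul A (charge_of \<theta>') \<gamma> = x)"

definition g_Z :: "(int ^ 'r::finite \<Rightarrow> complex) \<Rightarrow> (nat ^ 'r) list \<Rightarrow> rat" where
  "g_Z Z \<alpha> =
     (if \<forall>k\<in>{1..<length \<alpha>}. slope Z (sum_list (take k \<alpha>)) \<ge> slope Z (sum_list (drop k \<alpha>))
      then (-1) ^ (length \<alpha> - 1) /
        of_nat (card {k \<in> {1..<length \<alpha>}.
          slope Z (sum_list (take k \<alpha>)) = slope Z (sum_list (drop k \<alpha>))} + 1)
      else 0)"

definition g_star :: "(int ^ 'r::finite \<Rightarrow> int ^ 'r \<Rightarrow> int) \<Rightarrow> (nat ^ 'r) list \<Rightarrow> rat" where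
  "g_star B \<alpha> =
     (if \<forall>k\<in>{1..<length \<alpha>}.
           B (to_int_vec (sum_list (take k \<alpha>))) (to_int_vec (sum_list (drop k \<alpha>))) \<ge> 0
      then (-1) ^ (length \<alpha> - 1) /
        of_nat (card {k \<in> {1..<length \<alpha>}.
          B (to_int_vec (sum_list (take k \<alpha>))) (to_int_vec (sum_list (drop k \<alpha>))) = 0} + 1)
      else 0)"

text \<open>A plane rooted tree with \<open>n\<close> leaves is recorded together with the labelling of its \<open>i\<close>-th
  leaf by \<open>\<alpha>\<^sub>i\<close>; as \<open>\<alpha>\<close> is fixed, this is the same as the tree itself.\<close>

datatype 'l ptree = Leaf 'l | Node "'l ptree list"

fun leaves :: "'l ptree \<Rightarrow> 'l list" where
  "leaves (Leaf x) = [x]"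
| "leaves (Node ts) = concat (map leaves ts)"

text \<open>Internal vertices in preorder (so the root comes first), each represented by the full
  subtree below it. This has to be a list, since different vertices may carry equal subtrees.\<close>

fun internal_vertices :: "'l ptree \<Rightarrow> 'l ptree list" where
  "internal_vertices (Leaf x) = []"
| "internal_vertices (Node ts) = Node ts # concat (map internal_vertices ts)"

fun children :: "'l ptree \<Rightarrow> 'l ptree list" where
  "children (Leaf x) = []"
| "children (Node ts) = ts"

definition child_weights :: "'l::monoid_add ptree \<Rightarrow> 'l list" where
  "child_weights v = map (\<lambda>u. sum_list (leaves u)) (children v)"

definition trees :: "'l list \<Rightarrow> 'l ptree set" where
  "trees \<alpha> = {T. leaves T = \<alpha> \<and> (\<forall>v\<in>set (internal_vertices T). length (children v) \<ge> 2)}"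

lemma leaves_nonempty:
  "\<forall>v\<in>set (internal_vertices T). length (children v) \<ge> 2 \<Longrightarrow> leaves T \<noteq> []"
proof (induction T)
  case (Node ts)
  then obtain t ts' where "ts = t # ts'" by (cases ts) auto
  with Node show ?case by auto
qed simp

lemma finite_trees: "finite (trees \<alpha>)"
proof (induction "length \<alpha>" arbitrary: \<alpha> rule: less_induct)
  case less
  define Q where "Q = {\<beta>. set \<beta> \<subseteq> set \<alpha> \<and> length \<beta> < length \<alpha>}"
  define U where "U = (\<Union>\<beta>\<in>Q. trees \<beta>)"
  have "finite {\<beta>. set \<beta> \<subseteq> set \<alpha> \<and> length \<beta> \<le> length \<alpha>}"
    by (rule finite_lists_length_le) simp
  then have "finite Q" by (rule finite_subset[rotated]) (auto simp: Q_def)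
  then have finU: "finite U" using less by (auto simp: U_def Q_def)
  have "trees \<alpha> \<subseteq> Leaf ` set \<alpha> \<union> Node ` {ts. set ts \<subseteq> U \<and> length ts \<le> length \<alpha>}"
  proof
    fix T assume T: "T \<in> trees \<alpha>"
    show "T \<in> Leaf ` set \<alpha> \<union> Node ` {ts. set ts \<subseteq> U \<and> length ts \<le> length \<alpha>}"
    proof (cases T)
      case (Leaf x)
      then show ?thesis using T by (auto simp: trees_def)
    next
      case (Node ts)
      have len: "length ts \<ge> 2" and lv: "concat (map leaves ts) = \<alpha>"
        and good: "\<And>t. t \<in> set ts \<Longrightarrow> \<forall>v\<in>set (internal_vertices t). length (children v) \<ge> 2"
        using T by (auto simp: trees_def Node)
      have ne: "length us \<le> length (concat (map leaves us))" if "set us \<subseteq> set ts" for us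
        using that
      proof (induction us)
        case (Cons u us)
        then have "leaves u \<noteq> []" using good leaves_nonempty[of u] by auto
        then have "length (leaves u) \<ge> 1" by (cases "leaves u") auto
        with Cons show ?case by auto
      qed simp
      have "length ts \<le> length \<alpha>" using ne[of ts] lv by simp
      moreover have "t \<in> U" if t: "t \<in> set ts" for t
      proof -
        obtain us ws where ts: "ts = us @ t # ws" using t by (meson split_list)
        have "length us + length ws \<ge> 1" using len ts by simp
        moreover have "length us \<le> length (concat (map leaves us))"
          "length ws \<le> length (concat (map leaves ws))"
          using ne ts by auto
        moreover have "length \<alpha> = length (concat (map leaves us)) + length (leaves t) +
            length (concat (map leaves ws))"
          unfolding lv[symmetric] ts by simp
        ultimately have "length (leaves t) < length \<alpha>" by linarith
        moreover have "set (leaves t) \<subseteq> set \<alpha>" unfolding lv[symmetric] ts by auto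
        ultimately have "leaves t \<in> Q" by (simp add: Q_def)
        moreover have "t \<in> trees (leaves t)" using good[OF t] by (simp add: trees_def)
        ultimately show ?thesis by (auto simp: U_def)
      qed
      ultimately show ?thesis using Node by auto
    qed
  qed
  moreover have "finite {ts. set ts \<subseteq> U \<and> length ts \<le> length \<alpha>}"
    by (rule finite_lists_length_le[OF finU])
  ultimately show ?case by (meson finite_UnI finite_imageI finite_set finite_subset)
qed

definition F_coll ::
  "(int ^ 'r::finite \<Rightarrow> int ^ 'r \<Rightarrow> int) \<Rightarrow> (int ^ 'r \<Rightarrow> complex) \<Rightarrow> (nat ^ 'r) list \<Rightarrow> rat" where
  "F_coll B Z \<alpha> =
     (if length \<alpha> = 1 then 1
      else \<Sum>T\<in>trees \<alpha>. (-1) ^ (length (internal_vertices T) - 1) *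
        (g_Z Z (child_weights T) - g_star B (child_weights T)) *
        prod_list (map (\<lambda>v. g_star B (child_weights v)) (tl (internal_vertices T))))"

end

theory Submission
  imports Defs
begin

text \<open>
  Collections act on families of elements, and composing collections corresponds to composing
  their actions. Everything therefore reduces to expressing the two kinds of invariants through
  the family \<open>A\<close> itself: \<open>inv_bar_eq_act\<close> gives \<open>g_Z * A\<close> for the invariants of an arbitrary
  central charge, and \<open>attractor_inv_eq_act\<close> gives \<open>g_* * A\<close> for the attractor invariants. As
  \<open>g_*\<close> takes the value 1 on one-term sequences, it is invertible under composition, and solving
  the recursion for its inverse \<open>t\<close> produces a sum over plane trees in which every internal vertex
  contributes \<open>-g_*\<close> (\<open>comp_tree_sum\<close>). Hence \<open>A = t * attractor\<close> and the invariants of \<open>Z\<close> are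
  \<open>(g_Z o t) * attractor\<close>. In \<open>g_Z o t\<close> the splittings into at least two blocks give the trees whose
  root carries \<open>g_Z\<close>, and the trivial splitting gives \<open>t\<close>, that is, the trees whose root carries
  \<open>-g_*\<close>; together they are the difference at the root in \<open>F_Z\<close> (\<open>F_coll_eq_comp\<close>).

  The formula \<open>g_Z * A\<close>. The recursion that defines the invariants of \<open>Z\<close> is inverted by Reineke's
  alternating sum over the sequences all of whose proper prefixes have larger slope than the
  remaining terms. After grouping by splittings, each place between two consecutive terms
  contributes a factor of its own, namely the difference of the indicators of "the slope drops here"
  and "the prefix ending here has larger slope than the total". Were none of these factors zero, the
  prefix sums would drift away from the total (\<open>shifted_terms_drift\<close>). The logarithm then glues
  Reineke sequences of equal slope. Such a gluing is recovered from its result by cutting exactly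
  where a prefix has the slope of the total, so the denominator of the logarithm becomes the number
  of these places plus one.

  The formula \<open>g_* * A\<close>. Fix \<open>\<gamma>\<close>. Both \<open>g_Z\<close> and \<open>g_*\<close> depend only on the signs of the prefix sums
  of an additive real weight that vanishes at \<open>\<gamma>\<close>. Let \<open>v\<close> be the weight \<open>\<langle>-,\<gamma>\<rangle>\<close> that belongs to
  \<open>g_*\<close>, and \<open>w\<close> that of a stability parameter close to \<open>\<langle>-,\<gamma>\<rangle>\<close>; then \<open>w\<close> has the sign of \<open>v\<close>
  wherever \<open>v\<close> does not vanish. Cut a sequence where its \<open>v\<close>-prefix sum is zero. If \<open>a\<close> is the sum of
  the first block and \<open>b\<close> that of the others, then \<open>\<langle>a,b\<rangle> = \<langle>a,\<gamma>\<rangle> = 0\<close>, so the products over the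
  two parts commute: the product of the whole sequence is invariant under cyclic rotation of the
  blocks. A cycle lemma (\<open>sum_level_weight_rotate\<close>) says that the weight computed from \<open>w\<close> sums to 1
  over the rotations of the blocks, whatever \<open>w\<close> is. Averaging over rotations therefore gives the
  same result for \<open>w\<close> as for \<open>v\<close>. Generic parameters are dense, so this common value is the
  attractor invariant.
\<close>

section \<open>Composition of collections\<close>

definition splittings :: "'a list \<Rightarrow> 'a list list set" where
  "splittings xs = {bs. concat bs = xs \<and> [] \<notin> set bs}"

text \<open>The composition law for which the action becomes a left action (\<open>act_act\<close>).\<close>

definition coll_comp :: "('a::monoid_add list \<Rightarrow> rat) \<Rightarrow> ('a list \<Rightarrow> rat) \<Rightarrow> 'a list \<Rightarrow> rat" where
  "coll_comp F G xs = (\<Sum>bs\<in>splittings xs. F (map sum_list bs) * prod_list (map G bs))"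

lemma splittings_Nil: "splittings [] = {[]}"
  by (auto simp: splittings_def) (metis list.set_intros(1) neq_Nil_conv)

lemma splittings_singleton: "splittings [x] = {[[x]]}"
proof (intro equalityI subsetI)
  fix bs assume bs: "bs \<in> splittings [x]"
  then obtain b cs where "bs = b # cs" by (cases bs) (auto simp: splittings_def)
  with bs have "b = [x]" "cs \<in> splittings []"
    by (auto simp: splittings_def append_eq_Cons_conv)
  then show "bs \<in> {[[x]]}" using \<open>bs = b # cs\<close> by (simp add: splittings_Nil)
qed (simp add: splittings_def)

lemma splittings_Cons_Cons:
  "splittings (x # y # zs) =
     (\<lambda>bs. [x] # bs) ` splittings (y # zs) \<union> (\<lambda>bs. (x # hd bs) # tl bs) ` splittings (y # zs)"
  (is "?L = ?R")
proof
  show "?L \<subseteq> ?R"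
  proof
    fix bs assume "bs \<in> ?L"
    then have cat: "concat bs = x # y # zs" and ne: "[] \<notin> set bs"
      by (auto simp: splittings_def)
    then obtain b cs where bs: "bs = b # cs" by (cases bs) auto
    with ne cat obtain b' where b: "b = x # b'" by (cases b) auto
    show "bs \<in> ?R"
    proof (cases b')
      case Nil
      then show ?thesis using bs b cat ne by (auto simp: splittings_def)
    next
      case (Cons c b'')
      then have "b' # cs \<in> splittings (y # zs)" "bs = (x # hd (b' # cs)) # tl (b' # cs)"
        using bs b cat ne by (auto simp: splittings_def)
      then show ?thesis by blast
    qed
  qed
  show "?R \<subseteq> ?L"
  proof
    fix bs assume "bs \<in> ?R"
    then obtain cs where cs: "cs \<in> splittings (y # zs)"
      "bs = [x] # cs \<or> bs = (x # hd cs) # tl cs" by blast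
    then obtain c ds where "cs = c # ds" by (cases cs) (auto simp: splittings_def)
    then show "bs \<in> ?L" using cs by (auto simp: splittings_def)
  qed
qed

lemma finite_splittings: "finite (splittings xs)"
  by (induction xs rule: induct_list012)
    (simp_all add: splittings_Nil splittings_singleton splittings_Cons_Cons)

text \<open>The first term either forms a block of its own or joins the first block of a splitting of the
  remaining terms. This is the recursion along which sums over splittings are evaluated.\<close>

lemma sum_splittings_Cons_Cons:
  "(\<Sum>bs\<in>splittings (x # y # zs). f bs) =
     (\<Sum>bs\<in>splittings (y # zs). f ([x] # bs) + f ((x # hd bs) # tl bs))"
proof -
  let ?S = "splittings (y # zs)"
  have hd: "hd bs \<noteq> []" "bs \<noteq> []" if "bs \<in> ?S" for bs
    using that by (cases bs; auto simp: splittings_def)+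
  have inj: "inj_on (\<lambda>bs. (x # hd bs) # tl bs) ?S"
    by (rule inj_onI) (metis hd(2) list.collapse list.inject)
  have "(\<Sum>bs\<in>splittings (x # y # zs). f bs) =
      sum f ((\<lambda>bs. [x] # bs) ` ?S) + sum f ((\<lambda>bs. (x # hd bs) # tl bs) ` ?S)"
    unfolding splittings_Cons_Cons
    by (rule sum.union_disjoint) (use hd in \<open>fastforce simp: finite_splittings\<close>)+
  then show ?thesis
    by (simp add: sum.reindex inj sum.distrib)
qed

text \<open>Splitting off the trivial splitting isolates the leading term of a composition, which is what
  makes it possible to solve for inverses recursively.\<close>

lemma sum_splittings_split_trivial:
  assumes "xs \<noteq> []"
  shows "(\<Sum>bs\<in>splittings xs. f bs) = f [xs] + (\<Sum>bs | bs \<in> splittings xs \<and> 2 \<le> length bs. f bs)"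
proof -
  have eq: "splittings xs = insert [xs] {bs \<in> splittings xs. 2 \<le> length bs}"
  proof (intro equalityI subsetI)
    fix bs assume bs: "bs \<in> splittings xs"
    then have "bs \<noteq> []" using assms by (auto simp: splittings_def)
    then consider b where "bs = [b]" | "2 \<le> length bs"
      by (cases bs rule: remdups_adj.cases) auto
    then show "bs \<in> insert [xs] {bs \<in> splittings xs. 2 \<le> length bs}"
      using bs by cases (auto simp: splittings_def)
  qed (use assms in \<open>auto simp: splittings_def\<close>)
  have fin: "finite {bs \<in> splittings xs. 2 \<le> length bs}"
    using finite_splittings by (rule rev_finite_subset) auto
  show ?thesis by (subst eq, subst sum.insert) (simp_all add: fin)
qed

lemma in_listset_iff: "bs \<in> listset As \<longleftrightarrow> list_all2 (\<in>) bs As"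
  by (induction As arbitrary: bs) (auto simp: set_Cons_def list_all2_Cons2)

lemma finite_listset: "\<forall>A\<in>set As. finite A \<Longrightarrow> finite (listset As)"
proof (induction As)
  case (Cons A As)
  have "listset (A # As) = (\<lambda>(x, xs). x # xs) ` (A \<times> listset As)"
    by (auto simp: set_Cons_def)
  with Cons show ?case by simp
qed simp

lemma sum_listset_Cons:
  "(\<Sum>bs\<in>listset (A # As). f bs) = (\<Sum>b\<in>A. \<Sum>bs\<in>listset As. f (b # bs))"
proof -
  have "listset (A # As) = (\<lambda>(x, xs). x # xs) ` (A \<times> listset As)"
    by (auto simp: set_Cons_def)
  moreover have "inj_on (\<lambda>(x, xs). x # xs) (A \<times> listset As)"
    by (auto simp: inj_on_def)
  ultimately show ?thesis
    by (simp add: sum.reindex sum.cartesian_product case_prod_unfold)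
qed

lemma prod_list_sum_distrib:
  fixes f :: "'b \<Rightarrow> 'c::comm_semiring_1"
  shows "prod_list (map (\<lambda>a. \<Sum>b\<in>S a. f b) as) = (\<Sum>bs\<in>listset (map S as). prod_list (map f bs))"
  by (induction as) (simp_all add: sum_listset_Cons sum_product del: listset.simps(2))

lemma ordered_prod_Cons: "xs \<noteq> [] \<Longrightarrow> ordered_prod (x # xs) = x * ordered_prod xs"
  by (cases xs) auto

lemma ordered_prod_append:
  "xs \<noteq> [] \<Longrightarrow> ys \<noteq> [] \<Longrightarrow> ordered_prod (xs @ ys) = ordered_prod xs * ordered_prod ys"
  by (induction xs rule: induct_list012) (auto simp: ordered_prod_Cons mult.assoc)

lemma sum_list_dimvecs:
  assumes "xs \<noteq> []" "set xs \<subseteq> dimvecs" shows "sum_list xs \<in> dimvecs"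
  using length_le_vtotal[OF assms(2)] assms(1) by (auto simp: dimvecs_def)

lemma sum_list_concat: "sum_list (concat xss) = sum_list (map sum_list xss)"
  for xss :: "'m::monoid_add list list"
  by (induction xss) auto

context graded_rat_algebra begin

lemma ordered_prod_act:
  assumes "as \<noteq> []"
  shows "ordered_prod (map (act smul G H) as) =
    (\<Sum>bs\<in>listset (map decomps as). smul (prod_list (map G bs)) (ordered_prod (map H (concat bs))))"
  using assms
proof (induction as rule: induct_list012)
  case (2 a)
  show ?case by (simp add: sum_listset_Cons act_def del: listset.simps(2))
next
  case (3 a a' as)
  let ?S = "listset (map decomps (a' # as))"
  have ne: "concat bs \<noteq> []" if "bs \<in> ?S" for bs
    using that by (auto simp: set_Cons_def decomps_def)
  have ne': "b \<noteq> []" if "b \<in> decomps a" for b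
    using that by (auto simp: decomps_def)
  have "ordered_prod (map (act smul G H) (a # a' # as)) =
      act smul G H a * ordered_prod (map (act smul G H) (a' # as))" by simp
  also have "\<dots> = (\<Sum>b\<in>decomps a. \<Sum>bs\<in>?S. smul (G b) (ordered_prod (map H b)) *
      smul (prod_list (map G bs)) (ordered_prod (map H (concat bs))))"
    unfolding 3(2)[OF list.distinct(2)] by (simp only: act_def sum_product)
  also have "\<dots> = (\<Sum>b\<in>decomps a. \<Sum>bs\<in>?S.
      smul (prod_list (map G (b # bs))) (ordered_prod (map H (concat (b # bs)))))"
  proof (intro sum.cong refl)
    fix b bs assume "b \<in> decomps a" "bs \<in> ?S"
    then show "smul (G b) (ordered_prod (map H b)) *
        smul (prod_list (map G bs)) (ordered_prod (map H (concat bs))) =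
        smul (prod_list (map G (b # bs))) (ordered_prod (map H (concat (b # bs))))"
      using ne ne' by (simp add: ordered_prod_append smul_mult_left smul_mult_right)
  qed
  also have "\<dots> = (\<Sum>bs\<in>listset (map decomps (a # a' # as)).
      smul (prod_list (map G bs)) (ordered_prod (map H (concat bs))))"
    by (simp add: sum_listset_Cons del: listset.simps(2))
  finally show ?case .
qed simp

text \<open>Expanding every factor of a product turns a sequence with a decomposition of each of its terms
  into a refined sequence with a splitting; the coarse sequence is recovered from the block sums.\<close>

lemma act_act: "act smul F (act smul G H) \<gamma> = act smul (coll_comp F G) H \<gamma>"
proof -
  have "act smul F (act smul G H) \<gamma> =
      (\<Sum>as\<in>decomps \<gamma>. \<Sum>bs\<in>listset (map decomps as).
        smul (F as * prod_list (map G bs)) (ordered_prod (map H (concat bs))))"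
    unfolding act_def[of smul F]
    by (intro sum.cong refl) (simp add: ordered_prod_act scale_sum_right decomps_def)
  also have "\<dots> = (\<Sum>(as, bs)\<in>(SIGMA as:decomps \<gamma>. listset (map decomps as)).
      smul (F as * prod_list (map G bs)) (ordered_prod (map H (concat bs))))"
    by (rule sum.Sigma) (auto simp: finite_decomps intro!: finite_listset)
  also have "\<dots> = (\<Sum>(\<alpha>, bs)\<in>(SIGMA \<alpha>:decomps \<gamma>. splittings \<alpha>).
      smul (F (map sum_list bs) * prod_list (map G bs)) (ordered_prod (map H \<alpha>)))"
  proof (rule sum.reindex_bij_witness[where i = "\<lambda>(\<alpha>, bs). (map sum_list bs, bs)"
        and j = "\<lambda>(as, bs). (concat bs, bs)"])
    fix x assume "x \<in> (SIGMA as:decomps \<gamma>. listset (map decomps as))"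
    then obtain as bs where x: "x = (as, bs)" and as: "as \<in> decomps \<gamma>"
      and "bs \<in> listset (map decomps as)" by blast
    then have "list_all2 (\<lambda>b a. b \<in> decomps a) bs as"
      by (simp add: in_listset_iff list.rel_map)
    then have eq: "as = map sum_list bs" and bs: "\<forall>b\<in>set bs. b \<noteq> [] \<and> set b \<subseteq> dimvecs"
      by (induction rule: list_all2_induct) (auto simp: decomps_def)
    show "(case case x of (as, bs) \<Rightarrow> (concat bs, bs) of (\<alpha>, bs) \<Rightarrow> (map sum_list bs, bs)) = x"
      "(case case x of (as, bs) \<Rightarrow> (concat bs, bs) of (\<alpha>, bs) \<Rightarrow>
          smul (F (map sum_list bs) * prod_list (map G bs)) (ordered_prod (map H \<alpha>))) =
        (case x of (as, bs) \<Rightarrow>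
          smul (F as * prod_list (map G bs)) (ordered_prod (map H (concat bs))))"
      by (simp_all add: x eq)
    show "(case x of (as, bs) \<Rightarrow> (concat bs, bs)) \<in> (SIGMA \<alpha>:decomps \<gamma>. splittings \<alpha>)"
      using as bs eq by (auto simp: x decomps_def splittings_def sum_list_concat)
  next
    fix x assume "x \<in> (SIGMA \<alpha>:decomps \<gamma>. splittings \<alpha>)"
    then obtain \<alpha> bs where x: "x = (\<alpha>, bs)" and \<alpha>: "\<alpha> \<in> decomps \<gamma>"
      and "bs \<in> splittings \<alpha>" by blast
    then have cat: "concat bs = \<alpha>" and bs: "\<forall>b\<in>set bs. b \<noteq> [] \<and> set b \<subseteq> dimvecs"
      by (fastforce simp: splittings_def decomps_def)+
    show "(case case x of (\<alpha>, bs) \<Rightarrow> (map sum_list bs, bs) of (as, bs) \<Rightarrow> (concat bs, bs)) = x"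
      by (simp add: x cat)
    have "list_all2 (\<lambda>b a. b \<in> decomps a) bs (map sum_list bs)"
      using bs by (auto simp: list_all2_conv_all_nth decomps_def)
    moreover have "map sum_list bs \<in> decomps \<gamma>"
      using \<alpha> bs cat by (auto simp: decomps_def sum_list_concat intro: sum_list_dimvecs)
    ultimately show "(case x of (\<alpha>, bs) \<Rightarrow> (map sum_list bs, bs)) \<in>
        (SIGMA as:decomps \<gamma>. listset (map decomps as))"
      by (simp add: x in_listset_iff list.rel_map)
  qed
  also have "\<dots> = (\<Sum>\<alpha>\<in>decomps \<gamma>. \<Sum>bs\<in>splittings \<alpha>.
      smul (F (map sum_list bs) * prod_list (map G bs)) (ordered_prod (map H \<alpha>)))"
    by (rule sum.Sigma[symmetric]) (auto simp: finite_decomps finite_splittings)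
  also have "\<dots> = act smul (coll_comp F G) H \<gamma>"
    by (simp add: act_def coll_comp_def scale_sum_left)
  finally show ?thesis .
qed

lemma act_cong:
  assumes "\<And>\<alpha>. \<alpha> \<in> decomps \<gamma> \<Longrightarrow> F \<alpha> = G \<alpha>" "\<And>a. a \<in> dimvecs \<Longrightarrow> H a = K a"
  shows "act smul F H \<gamma> = act smul G K \<gamma>"
  unfolding act_def
  by (intro sum.cong refl arg_cong2[where f = smul] arg_cong[where f = ordered_prod] map_cong)
    (use assms in \<open>auto simp: decomps_def\<close>)

lemma act_split_singleton:
  assumes "\<gamma> \<in> dimvecs"
  shows "act smul F H \<gamma> = smul (F [\<gamma>]) (H \<gamma>) +
    (\<Sum>\<alpha> | \<alpha> \<in> decomps \<gamma> \<and> 2 \<le> length \<alpha>. smul (F \<alpha>) (ordered_prod (map H \<alpha>)))"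
proof -
  have eq: "decomps \<gamma> = insert [\<gamma>] {\<alpha> \<in> decomps \<gamma>. 2 \<le> length \<alpha>}"
  proof (intro equalityI subsetI)
    fix \<alpha> assume \<alpha>: "\<alpha> \<in> decomps \<gamma>"
    then have "\<alpha> \<noteq> []" by (auto simp: decomps_def)
    then consider a where "\<alpha> = [a]" | "2 \<le> length \<alpha>"
      by (cases \<alpha> rule: remdups_adj.cases) auto
    then show "\<alpha> \<in> insert [\<gamma>] {\<alpha> \<in> decomps \<gamma>. 2 \<le> length \<alpha>}"
      using \<alpha> by cases (auto simp: decomps_def)
  qed (use assms in \<open>auto simp: decomps_def\<close>)
  have fin: "finite {\<alpha> \<in> decomps \<gamma>. 2 \<le> length \<alpha>}"
    using finite_decomps by (rule rev_finite_subset) auto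
  show ?thesis unfolding act_def by (subst eq, subst sum.insert) (simp_all add: fin)
qed

lemma act_identity:
  assumes "\<gamma> \<in> dimvecs" "\<And>\<alpha>. \<alpha> \<in> decomps \<gamma> \<Longrightarrow> F \<alpha> = (if length \<alpha> = 1 then 1 else 0)"
  shows "act smul F H \<gamma> = H \<gamma>"
proof -
  have "[\<gamma>] \<in> decomps \<gamma>" using assms(1) by (simp add: decomps_def)
  then show ?thesis by (simp add: act_split_singleton[OF assms(1)] assms(2))
qed

text \<open>The action is unitriangular with respect to \<open>vtotal\<close>: the value at \<open>\<gamma>\<close> is the leading term
  \<open>H \<gamma>\<close> plus terms that only involve smaller arguments.\<close>

lemma act_injective:
  assumes F: "\<And>a. a \<in> dimvecs \<Longrightarrow> F [a] = 1"
    and eq: "\<And>a. a \<in> dimvecs \<Longrightarrow> act smul F H a = act smul F K a"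
    and "\<gamma> \<in> dimvecs"
  shows "H \<gamma> = K \<gamma>"
  using assms(3)
proof (induction "vtotal \<gamma>" arbitrary: \<gamma> rule: less_induct)
  case less
  have "map H \<alpha> = map K \<alpha>" if "\<alpha> \<in> decomps \<gamma>" "2 \<le> length \<alpha>" for \<alpha>
    using less.hyps vtotal_member_less[OF that] that(1) by (auto simp: decomps_def)
  then have "(\<Sum>\<alpha> | \<alpha> \<in> decomps \<gamma> \<and> 2 \<le> length \<alpha>. smul (F \<alpha>) (ordered_prod (map H \<alpha>))) =
      (\<Sum>\<alpha> | \<alpha> \<in> decomps \<gamma> \<and> 2 \<le> length \<alpha>. smul (F \<alpha>) (ordered_prod (map K \<alpha>)))"
    by (intro sum.cong refl) (metis (mono_tags, lifting) mem_Collect_eq)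
  then show ?case using eq[OF less.prems] F[OF less.prems]
    by (simp add: act_split_singleton[OF less.prems])
qed

end

section \<open>Prefix sums and excursions\<close>

text \<open>The empty prefix is included and the full sequence is excluded. In this way a sequence of total
  zero has one prefix sum for each of its rotations, and the zero of the empty prefix accounts for the
  summand 1 in \<open>n\<^sub>0 + 1\<close>.\<close>

definition prefix_sums :: "real list \<Rightarrow> real list" where
  "prefix_sums us = map (\<lambda>k. sum_list (take k us)) [0..<length us]"

lemma prefix_sums_Nil [simp]: "prefix_sums [] = []"
  by (simp add: prefix_sums_def)

lemma length_prefix_sums [simp]: "length (prefix_sums us) = length us"
  by (simp add: prefix_sums_def)

lemma prefix_sums_Cons [simp]: "prefix_sums (u # us) = 0 # map ((+) u) (prefix_sums us)"
  unfolding prefix_sums_def length_Cons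
  by (subst upt_conv_Cons) (simp_all add: map_Suc_upt[symmetric] comp_def del: upt_Suc)

lemma prefix_sums_eq_Nil_iff [simp]: "prefix_sums us = [] \<longleftrightarrow> us = []"
  by (cases us) simp_all

lemma prefix_sums_append:
  "prefix_sums (us @ vs) = prefix_sums us @ map ((+) (sum_list us)) (prefix_sums vs)"
  by (induction us) (auto simp: comp_def add.assoc)

text \<open>The common shape of \<open>g_Z\<close> and \<open>g_star\<close> up to sign.\<close>

definition level_weight :: "real list \<Rightarrow> rat" where
  "level_weight us =
     (if \<forall>s\<in>set (prefix_sums us). 0 \<le> s then 1 / of_nat (count_list (prefix_sums us) 0) else 0)"

lemma prefix_sums_rotate1:
  assumes "sum_list us = 0"
  shows "prefix_sums (rotate1 us) = map (\<lambda>s. s - hd us) (rotate1 (prefix_sums us))"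
proof (cases us)
  case (Cons u vs)
  then show ?thesis using assms
    by (auto simp: prefix_sums_append comp_def)
qed simp

lemma mset_rotate: "mset (rotate j xs) = mset xs"
proof (induction j)
  case (Suc j)
  have "mset (rotate1 ys) = mset ys" for ys :: "'a list" by (cases ys) simp_all
  with Suc show ?case by simp
qed simp

lemma prefix_sums_rotate:
  assumes "sum_list us = 0"
  shows "\<exists>c. prefix_sums (rotate j us) = map (\<lambda>s. s - c) (rotate j (prefix_sums us))"
proof (induction j)
  case 0
  show ?case by (rule exI[of _ 0]) simp
next
  case (Suc j)
  then obtain c where c: "prefix_sums (rotate j us) = map (\<lambda>s. s - c) (rotate j (prefix_sums us))"
    by blast
  have "sum_list (rotate j us) = 0"
    using assms by (metis mset_rotate sum_mset_sum_list)
  from prefix_sums_rotate1[OF this]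
  have "prefix_sums (rotate (Suc j) us) =
      map (\<lambda>s. s - (c + hd (rotate j us))) (rotate (Suc j) (prefix_sums us))"
    by (simp add: c rotate1_map comp_def algebra_simps)
  then show ?case by blast
qed

text \<open>Rotating a sequence of total zero rotates its prefix sums and moves their base point. So the
  rotation starting at position \<open>j\<close> has nonnegative prefix sums precisely when the \<open>j\<close>-th prefix sum
  is minimal, and its zeros are the places where this minimum is attained.\<close>

lemma level_weight_rotate:
  assumes "sum_list us = 0" "j < length us"
  defines "S \<equiv> prefix_sums us"
  shows "level_weight (rotate j us) =
    (if \<forall>s\<in>set S. S ! j \<le> s then 1 / of_nat (count_list S (S ! j)) else 0)"
proof -
  have ne: "us \<noteq> []" using assms(2) by auto
  then obtain c where c: "prefix_sums (rotate j us) = map (\<lambda>s. s - c) (rotate j S)"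
    using prefix_sums_rotate[OF assms(1)] unfolding S_def by blast
  have "rotate j us \<noteq> []" using ne by simp
  then obtain v vs where "rotate j us = v # vs" by (cases "rotate j us") auto
  then have "hd (prefix_sums (rotate j us)) = 0" by simp
  moreover have "hd (rotate j S) = S ! j"
    using assms(2) ne by (simp add: hd_rotate_conv_nth S_def)
  moreover have "rotate j S \<noteq> []" using ne by (simp add: S_def)
  ultimately have cj: "c = S ! j" by (simp add: c hd_map)
  have "count_list (map (\<lambda>s. s - c) (rotate j S)) 0 = count_list (rotate j S) c"
    by (simp add: count_list_eq_length_filter filter_map comp_def)
      (rule arg_cong[where f = length], rule filter_cong, auto)
  also have "\<dots> = count_list S c"
    by (simp add: mset_rotate flip: count_mset)
  finally show ?thesis
    by (simp add: level_weight_def c cj)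
qed

text \<open>The cycle lemma: exactly the rotations that start at a minimal prefix sum contribute, and each
  of them contributes the reciprocal of the number of minima.\<close>

lemma sum_level_weight_rotate:
  assumes "sum_list us = 0" "us \<noteq> []"
  shows "(\<Sum>j<length us. level_weight (rotate j us)) = 1"
proof -
  define S where "S = prefix_sums us"
  define m where "m = Min (set S)"
  have S: "S \<noteq> []" "length S = length us" using assms(2) by (auto simp: S_def)
  have m: "m \<in> set S" "\<forall>s\<in>set S. m \<le> s" using S unfolding m_def by auto
  have "(\<Sum>j<length us. level_weight (rotate j us)) =
      (\<Sum>j<length S. if S ! j = m then 1 / of_nat (count_list S m) else 0)"
  proof (rule sum.cong)
    fix j assume "j \<in> {..<length S}"
    then have j: "j < length S" by simp
    then have "S ! j \<in> set S" by simp
    then have "(\<forall>s\<in>set S. S ! j \<le> s) \<longleftrightarrow> S ! j = m" using m by (auto intro: antisym)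
    then show "level_weight (rotate j us) = (if S ! j = m then 1 / of_nat (count_list S m) else 0)"
      using level_weight_rotate[OF assms(1), of j] j S by (auto simp: S_def)
  qed (simp add: S)
  also have "\<dots> = of_nat (card {j. j < length S \<and> S ! j = m}) * (1 / of_nat (count_list S m))"
    by (simp add: sum.If_cases Int_def)
  also have "card {j. j < length S \<and> S ! j = m} = count_list S m"
    by (simp add: count_list_eq_length_filter length_filter_conv_card eq_commute)
  also have "of_nat (count_list S m) * (1 / of_nat (count_list S m)) = (1::rat)"
    using m(1) by (simp add: count_list_0_iff)
  finally show ?thesis .
qed

text \<open>The blocks obtained when a sequence is cut at every zero of its prefix sums.\<close>

definition excursion :: "real list \<Rightarrow> bool" where
  "excursion us \<longleftrightarrow> us \<noteq> [] \<and> sum_list us = 0 \<and> (\<forall>s\<in>set (tl (prefix_sums us)). 0 < s)"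

lemma excursion_map_nonempty: "excursion (map w b) \<Longrightarrow> b \<noteq> []"
  by (simp add: excursion_def)

lemma excursions_concat:
  assumes "\<forall>u\<in>set uss. excursion u"
  shows "sum_list (concat uss) = 0" "\<forall>s\<in>set (prefix_sums (concat uss)). 0 \<le> s"
    "count_list (prefix_sums (concat uss)) 0 = length uss"
proof -
  have "sum_list (concat uss) = 0 \<and> (\<forall>s\<in>set (prefix_sums (concat uss)). 0 \<le> s) \<and>
    count_list (prefix_sums (concat uss)) 0 = length uss"
    using assms
  proof (induction uss)
    case (Cons u uss)
    then obtain v vs where u: "u = v # vs" by (cases u) (auto simp: excursion_def)
    have pos: "\<forall>s\<in>set (map ((+) v) (prefix_sums vs)). 0 < s" and "sum_list u = 0"
      using Cons.prems by (auto simp: excursion_def u)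
    moreover have "count_list (map ((+) v) (prefix_sums vs)) 0 = 0"
      using pos by (intro iffD2[OF count_list_0_iff]) force
    ultimately show ?case using Cons
      by (force simp: prefix_sums_append u count_list_append map_idI)
  qed simp
  then show "sum_list (concat uss) = 0" "\<forall>s\<in>set (prefix_sums (concat uss)). 0 \<le> s"
    "count_list (prefix_sums (concat uss)) 0 = length uss" by blast+
qed

lemma excursion_not_decomposable:
  assumes "us \<noteq> []" "sum_list us = 0" "vs \<noteq> []" shows "\<not> excursion (us @ vs)"
proof -
  obtain v ws where "vs = v # ws" using assms(3) by (cases vs) auto
  moreover have "tl (prefix_sums us @ ys) = tl (prefix_sums us) @ ys" for ys
    using assms(1) by (cases us) auto
  ultimately show ?thesis using assms(2) by (auto simp: excursion_def prefix_sums_append)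
qed

text \<open>If two such decompositions started differently, the shorter first block would be a proper prefix
  of total zero of the longer one.\<close>

lemma excursions_unique:
  assumes "\<forall>b\<in>set bs. excursion (map w b)" "\<forall>c\<in>set cs. excursion (map w c)"
    "concat bs = concat cs"
  shows "bs = cs"
  using assms
proof (induction bs arbitrary: cs)
  case Nil
  show ?case
  proof (cases cs)
    case (Cons c cs')
    then have "c \<noteq> []" using Nil.prems(2) excursion_map_nonempty[of w c] by simp
    moreover have "c @ concat cs' = []" using Nil.prems(3) unfolding Cons concat.simps by (rule sym)
    ultimately show ?thesis by blast
  qed simp
next
  case (Cons b bs)
  have "b \<noteq> []" using Cons.prems(1) excursion_map_nonempty[of w b] by simp
  then have "concat cs \<noteq> []" unfolding Cons.prems(3)[symmetric] by simp
  then obtain c cs' where cs: "cs = c # cs'" by (cases cs) simp_all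
  have eq: "b @ concat bs = c @ concat cs'" using Cons.prems cs by simp
  have ex: "excursion (map w b)" "excursion (map w c)" using Cons.prems cs by auto
  have "b = c"
  proof -
    from eq obtain ds where "b @ ds = c \<or> c @ ds = b"
      by (auto simp: append_eq_append_conv2)
    moreover have "ds = []" if "excursion (map w x)" "excursion (map w (x @ ds))" for x
      using that excursion_not_decomposable[of "map w x" "map w ds"] by (auto simp: excursion_def)
    ultimately show ?thesis using ex by (metis append_Nil2)
  qed
  moreover from this have "bs = cs'" using eq Cons.prems(1,2) cs by (intro Cons.IH) simp_all
  ultimately show ?case using cs by simp
qed

text \<open>A zero strictly inside the sequence cuts it into two shorter sequences of the same kind.\<close>

lemma excursions_exist:
  assumes "sum_list (map w xs) = 0" "\<forall>s\<in>set (prefix_sums (map w xs)). 0 \<le> s"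
  shows "\<exists>bs. concat bs = xs \<and> (\<forall>b\<in>set bs. excursion (map w b))"
  using assms
proof (induction "length xs" arbitrary: xs rule: less_induct)
  case less
  show ?case
  proof (cases "xs = [] \<or> excursion (map w xs)")
    case True
    then show ?thesis
    proof
      assume "xs = []" then show ?thesis by (intro exI[of _ "[]"]) auto
    next
      assume "excursion (map w xs)" then show ?thesis by (intro exI[of _ "[xs]"]) auto
    qed
  next
    case False
    then obtain s where s: "s \<in> set (tl (prefix_sums (map w xs)))" "s \<le> 0"
      using less.prems by (auto simp: excursion_def not_less)
    then have "s \<in> set (prefix_sums (map w xs))"
      using list.set_sel(2)[of "prefix_sums (map w xs)"] by (cases "prefix_sums (map w xs)") auto
    then have s0: "s = 0" using s less.prems by (auto intro: antisym)
    obtain i where i: "i < length (tl (prefix_sums (map w xs)))" "tl (prefix_sums (map w xs)) ! i = s"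
      using s by (auto simp: in_set_conv_nth)
    define k where "k = Suc i"
    have k: "0 < k" "k < length xs" "sum_list (map w (take k xs)) = 0"
      using i s0 by (auto simp: k_def nth_tl prefix_sums_def take_map)
    have xs: "map w xs = map w (take k xs) @ map w (drop k xs)" by (simp flip: map_append)
    have sd: "sum_list (map w (drop k xs)) = 0"
      using less.prems(1) k(3) unfolding xs by simp
    have "\<exists>bs. concat bs = take k xs \<and> (\<forall>b\<in>set bs. excursion (map w b))"
      using less.prems(2) k unfolding xs prefix_sums_append by (intro less.hyps) auto
    moreover have "\<exists>bs. concat bs = drop k xs \<and> (\<forall>b\<in>set bs. excursion (map w b))"
      using less.prems(2) k sd unfolding xs prefix_sums_append by (intro less.hyps) auto
    ultimately obtain bs cs where "concat bs = take k xs" "\<forall>b\<in>set bs. excursion (map w b)"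
      "concat cs = drop k xs" "\<forall>b\<in>set cs. excursion (map w b)" by blast
    then show ?thesis by (intro exI[of _ "bs @ cs"]) auto
  qed
qed

section \<open>Slope conditions as signs of prefix sums\<close>

lemma to_int_vec_add: "to_int_vec (a + b) = to_int_vec a + to_int_vec b"
  by (simp add: to_int_vec_def vec_eq_iff)

lemma to_int_vec_zero: "to_int_vec 0 = 0"
  by (simp add: to_int_vec_def vec_eq_iff)

text \<open>The imaginary part is assumed positive on coordinate vectors only; it is additive, so removing
  one coordinate vector at a time extends positivity to all nonzero vectors.\<close>

lemma central_charge_Im_pos:
  assumes "central_charge Z" "a \<in> dimvecs"
  shows "0 < Im (Z (to_int_vec a))"
proof -
  have add: "Z (x + y) = Z x + Z y" for x y using assms(1) by (simp add: central_charge_def)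
  have zero: "Z 0 = 0" using add[of 0 0] by simp
  have "a \<noteq> 0 \<Longrightarrow> 0 < Im (Z (to_int_vec a))"
  proof (induction "vtotal a" arbitrary: a rule: less_induct)
    case less
    then obtain k where k: "a $ k \<noteq> 0" by (auto simp: vec_eq_iff)
    define b where "b = (\<chi> i. a $ i - axis k 1 $ i)"
    have a: "a = axis k 1 + b" using k by (auto simp: b_def vec_eq_iff axis_def)
    have e: "to_int_vec (axis k 1) = axis k 1" by (auto simp: to_int_vec_def vec_eq_iff axis_def)
    have "0 < Im (Z (axis k 1))" using assms(1) by (simp add: central_charge_def)
    moreover have "0 \<le> Im (Z (to_int_vec b))"
    proof (cases "b = 0")
      case False
      have "0 < vtotal (axis k 1 :: nat ^ 'a)"
        by (rule vtotal_pos) (auto simp: dimvecs_def vec_eq_iff axis_def)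
      then have "vtotal b < vtotal a" by (simp add: a)
      with less.hyps False show ?thesis by fastforce
    qed (simp add: to_int_vec_zero zero)
    ultimately show ?case by (simp add: a to_int_vec_add add e del: One_nat_def)
  qed
  then show ?thesis using assms(2) by (simp add: dimvecs_def)
qed

text \<open>Clearing denominators in the comparison of the slopes of \<open>a\<close> and \<open>\<gamma>\<close> gives a quantity that is
  additive in \<open>a\<close>; this turns conditions on slopes of partial sums into conditions on prefix sums of
  real numbers.\<close>

definition slope_excess :: "(int ^ 'r::finite \<Rightarrow> complex) \<Rightarrow> nat ^ 'r \<Rightarrow> nat ^ 'r \<Rightarrow> real" where
  "slope_excess Z \<gamma> a =
     Re (Z (to_int_vec \<gamma>)) * Im (Z (to_int_vec a)) - Re (Z (to_int_vec a)) * Im (Z (to_int_vec \<gamma>))"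

lemma slope_excess_self [simp]: "slope_excess Z \<gamma> \<gamma> = 0"
  by (simp add: slope_excess_def)

lemma slope_excess_sum_list:
  assumes "central_charge Z"
  shows "slope_excess Z \<gamma> (sum_list xs) = sum_list (map (slope_excess Z \<gamma>) xs)"
proof -
  have add: "Z (x + y) = Z x + Z y" for x y using assms by (simp add: central_charge_def)
  have zero: "Z 0 = 0" using add[of 0 0] by simp
  show ?thesis
    by (induction xs) (simp_all add: slope_excess_def to_int_vec_zero to_int_vec_add add zero algebra_simps)
qed

lemma slope_compare:
  assumes "central_charge Z" "a \<in> dimvecs" "b \<in> dimvecs"
  shows slope_less_iff: "slope Z b < slope Z a \<longleftrightarrow> 0 < slope_excess Z b a"
    and slope_le_iff: "slope Z b \<le> slope Z a \<longleftrightarrow> 0 \<le> slope_excess Z b a"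
    and slope_eq_iff: "slope Z a = slope Z b \<longleftrightarrow> slope_excess Z b a = 0"
  using central_charge_Im_pos[OF assms(1,2)] central_charge_Im_pos[OF assms(1,3)]
  by (auto simp: slope_def slope_excess_def field_simps)

text \<open>Comparing a part with the rest is the same as comparing it with the whole.\<close>

lemma slope_excess_add:
  assumes "central_charge Z"
  shows "slope_excess Z (a + b) a = slope_excess Z b a"
  using assms by (simp add: slope_excess_def central_charge_def to_int_vec_add algebra_simps)

lemma decomps_take_drop:
  assumes "\<alpha> \<in> decomps \<gamma>" "k \<in> {1..<length \<alpha>}"
  shows "sum_list (take k \<alpha>) \<in> dimvecs" "sum_list (drop k \<alpha>) \<in> dimvecs"
    "sum_list (take k \<alpha>) + sum_list (drop k \<alpha>) = \<gamma>"
proof -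
  show "sum_list (take k \<alpha>) \<in> dimvecs" "sum_list (drop k \<alpha>) \<in> dimvecs"
    using assms by (auto simp: decomps_def intro!: sum_list_dimvecs dest: in_set_takeD in_set_dropD)
  show "sum_list (take k \<alpha>) + sum_list (drop k \<alpha>) = \<gamma>"
    using assms by (simp add: decomps_def flip: sum_list_append)
qed

lemma decomps_total: "\<alpha> \<in> decomps \<gamma> \<Longrightarrow> \<gamma> \<in> dimvecs"
  by (auto simp: decomps_def intro: sum_list_dimvecs)

lemma slope_take_drop:
  assumes "central_charge Z" "\<alpha> \<in> decomps \<gamma>" "k \<in> {1..<length \<alpha>}"
  defines "a \<equiv> sum_list (take k \<alpha>)" and "b \<equiv> sum_list (drop k \<alpha>)"
  shows "slope Z b < slope Z a \<longleftrightarrow> 0 < slope_excess Z \<gamma> a"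
    "slope Z b \<le> slope Z a \<longleftrightarrow> 0 \<le> slope_excess Z \<gamma> a"
    "slope Z a = slope Z b \<longleftrightarrow> slope_excess Z \<gamma> a = 0"
  using decomps_take_drop[OF assms(2,3)] slope_compare[OF assms(1), of a b]
    slope_excess_add[OF assms(1), of a b]
  by (auto simp: a_def b_def)

lemma prefix_sums_map:
  assumes "\<And>xs. w (sum_list xs) = sum_list (map w xs)"
  shows "prefix_sums (map w xs) = map (\<lambda>k. w (sum_list (take k xs))) [0..<length xs]"
  by (simp add: prefix_sums_def assms take_map)

lemma tl_prefix_sums_map:
  assumes "\<And>xs. w (sum_list xs) = sum_list (map w xs)"
  shows "set (tl (prefix_sums (map w xs))) = (\<lambda>k. w (sum_list (take k xs))) ` {1..<length xs}"
  by (simp add: prefix_sums_map[OF assms] flip: map_tl)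

text \<open>The abstract form of the definitions of \<open>g_Z\<close> and \<open>g_star\<close>, covering both at once: \<open>P\<close> and
  \<open>Q\<close> stand for the inequality and the equality that occur there.\<close>

lemma signed_level_weight_eq:
  assumes w: "\<And>xs. w (sum_list xs) = sum_list (map w xs)" and ne: "xs \<noteq> []"
    and P: "\<And>k. k \<in> {1..<length xs} \<Longrightarrow> P k \<longleftrightarrow> 0 \<le> w (sum_list (take k xs))"
    and Q: "\<And>k. k \<in> {1..<length xs} \<Longrightarrow> Q k \<longleftrightarrow> w (sum_list (take k xs)) = 0"
  shows "(if \<forall>k\<in>{1..<length xs}. P k
      then (-1) ^ (length xs - 1) / of_nat (card {k \<in> {1..<length xs}. Q k} + 1) else 0) =
    (-1) ^ (length xs - 1) * level_weight (map w xs)"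
proof -
  have w0: "w 0 = 0" using w[of "[]"] by simp
  obtain n where n: "length xs = Suc n" using ne by (cases xs) auto
  have upt: "{0..<length xs} = insert 0 {1..<length xs}" by (auto simp: n)
  have ge: "(\<forall>s\<in>set (prefix_sums (map w xs)). 0 \<le> s) \<longleftrightarrow> (\<forall>k\<in>{1..<length xs}. P k)"
    using P by (simp add: prefix_sums_map[OF w] upt w0 del: One_nat_def)
  have "count_list (prefix_sums (map w xs)) 0 = card {k. k < length xs \<and> w (sum_list (take k xs)) = 0}"
    unfolding prefix_sums_map[OF w] count_list_eq_length_filter length_filter_conv_card
    by (intro arg_cong[where f = card]) auto
  also have "{k. k < length xs \<and> w (sum_list (take k xs)) = 0} = insert 0 {k \<in> {1..<length xs}. Q k}"
    using Q upt w0 by (auto simp: n)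
  also have "card \<dots> = card {k \<in> {1..<length xs}. Q k} + 1" by simp
  finally show ?thesis by (simp add: level_weight_def ge)
qed

lemma g_Z_eq:
  assumes "central_charge Z" "\<alpha> \<in> decomps \<gamma>"
  shows "g_Z Z \<alpha> = (-1) ^ (length \<alpha> - 1) * level_weight (map (slope_excess Z \<gamma>) \<alpha>)"
  unfolding g_Z_def
  by (rule signed_level_weight_eq[OF slope_excess_sum_list[OF assms(1)]])
    (use assms slope_take_drop[OF assms] in \<open>auto simp: decomps_def\<close>)

section \<open>Reineke inversion and the logarithm\<close>

definition hn_coll :: "(int ^ 'r::finite \<Rightarrow> complex) \<Rightarrow> (nat ^ 'r) list \<Rightarrow> rat" where
  "hn_coll Z \<alpha> = (if slope_decreasing Z \<alpha> then 1 else 0)"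

text \<open>The coefficients of Reineke's resolution of the recursion given by \<open>hn_coll\<close>.\<close>

definition reineke_coll :: "(int ^ 'r::finite \<Rightarrow> complex) \<Rightarrow> (nat ^ 'r) list \<Rightarrow> rat" where
  "reineke_coll Z \<alpha> =
     (if \<forall>k\<in>{1..<length \<alpha>}. slope Z (sum_list (drop k \<alpha>)) < slope Z (sum_list (take k \<alpha>))
      then (-1) ^ (length \<alpha> - 1) else 0)"

text \<open>The logarithm multiplies several sequences of equal slope, and these are measured against their
  common total. This is why the reference vector \<open>\<gamma>\<close> is any vector of the slope of the sequence.\<close>

lemma reineke_coll_eq:
  assumes "central_charge Z" "\<alpha> \<in> decomps \<delta>" "\<gamma> \<in> dimvecs" "slope Z \<delta> = slope Z \<gamma>"
  shows "reineke_coll Z \<alpha> =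
    (if \<forall>s\<in>set (tl (prefix_sums (map (slope_excess Z \<gamma>) \<alpha>))). 0 < s
     then (-1) ^ (length \<alpha> - 1) else 0)"
proof -
  have "slope Z (sum_list (drop k \<alpha>)) < slope Z (sum_list (take k \<alpha>)) \<longleftrightarrow>
      0 < slope_excess Z \<gamma> (sum_list (take k \<alpha>))" if "k \<in> {1..<length \<alpha>}" for k
    using slope_take_drop(1)[OF assms(1,2) that] decomps_take_drop(1)[OF assms(2) that] assms
      slope_less_iff[OF assms(1)] decomps_total[OF assms(2)] by metis
  then show ?thesis
    by (simp add: reineke_coll_def tl_prefix_sums_map slope_excess_sum_list[OF assms(1)])
qed

text \<open>The summand in the composition of \<open>reineke_coll\<close> with \<open>hn_coll\<close>, for the tail of a longer
  sequence: \<open>p\<close> is the weight of the terms that precede this tail.\<close>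

definition shifted_term ::
  "(int ^ 'r::finite \<Rightarrow> complex) \<Rightarrow> (nat ^ 'r \<Rightarrow> real) \<Rightarrow> real \<Rightarrow> (nat ^ 'r) list list \<Rightarrow> rat" where
  "shifted_term Z w p bs =
     (if \<forall>s\<in>set (tl (prefix_sums (map (\<lambda>b. w (sum_list b)) bs))). 0 < p + s
      then (-1) ^ (length bs - 1) else 0) * prod_list (map (hn_coll Z) bs)"

text \<open>The place after \<open>x\<close> either lies inside a block, which requires the slope to drop there, or is a
  cut, which requires a positive prefix sum and changes the sign. These conditions do not involve the
  other places, so they come out as a factor.\<close>

lemma sum_shifted_term_Cons_Cons:
  fixes w :: "nat ^ 'r::finite \<Rightarrow> real"
  assumes w: "\<And>xs. w (sum_list xs) = sum_list (map w xs)"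
  shows "(\<Sum>bs\<in>splittings (x # y # zs). shifted_term Z w p bs) =
    (of_bool (slope Z y < slope Z x) - of_bool (0 < p + w x)) *
    (\<Sum>bs\<in>splittings (y # zs). shifted_term Z w (p + w x) bs)"
  unfolding sum_splittings_Cons_Cons sum_distrib_left
proof (intro sum.cong refl)
  fix bs assume "bs \<in> splittings (y # zs)"
  then obtain b cs where bs: "bs = (y # b) # cs"
    by (cases bs; cases "hd bs") (auto simp: splittings_def)
  have "shifted_term Z w p ([x] # bs) = - of_bool (0 < p + w x) * shifted_term Z w (p + w x) bs"
    by (auto simp: shifted_term_def bs hn_coll_def slope_decreasing_def add.assoc)
  moreover have "shifted_term Z w p ((x # hd bs) # tl bs) =
      of_bool (slope Z y < slope Z x) * shifted_term Z w (p + w x) bs"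
    by (auto simp: shifted_term_def bs hn_coll_def slope_decreasing_def add.assoc w)
  ultimately show "shifted_term Z w p ([x] # bs) + shifted_term Z w p ((x # hd bs) # tl bs) =
      (of_bool (slope Z y < slope Z x) - of_bool (0 < p + w x)) * shifted_term Z w (p + w x) bs"
    by (simp add: algebra_simps)
qed

text \<open>If the sum is nonzero, then at each place exactly one of the two conditions holds. With a positive
  prefix sum the slope cannot drop, so a term of slope above that of \<open>\<gamma>\<close> is followed by another such
  term, and the prefix sums stay positive up to the end. Below, the argument is symmetric.\<close>

lemma shifted_terms_drift:
  fixes Z :: "int ^ 'r::finite \<Rightarrow> complex" and p :: real
  assumes Z: "central_charge Z" and \<gamma>: "\<gamma> \<in> dimvecs"
  defines "w \<equiv> slope_excess Z \<gamma>"
  assumes "set (x # xs) \<subseteq> dimvecs"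
    and "(\<Sum>bs\<in>splittings (x # xs). shifted_term Z w p bs) \<noteq> 0"
  shows "(0 \<le> p \<longrightarrow> 0 < w x \<longrightarrow> 0 < p + w (sum_list (x # xs))) \<and>
    (p \<le> 0 \<longrightarrow> w x < 0 \<longrightarrow> p + w (sum_list (x # xs)) < 0)"
  using assms(4-)
proof (induction xs arbitrary: x p)
  case (Cons y zs)
  have w: "w (sum_list xs) = sum_list (map w xs)" for xs
    unfolding w_def by (rule slope_excess_sum_list[OF Z])
  have wadd: "w (a + b) = w a + w b" for a b using w[of "[a, b]"] by simp
  have flip: "(slope Z y < slope Z x) \<noteq> (0 < p + w x)"
    and ne: "(\<Sum>bs\<in>splittings (y # zs). shifted_term Z w (p + w x) bs) \<noteq> 0"
    using Cons.prems(2) unfolding sum_shifted_term_Cons_Cons[OF w] by auto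
  have pos: "slope Z \<gamma> < slope Z a \<longleftrightarrow> 0 < w a" and neg: "slope Z a < slope Z \<gamma> \<longleftrightarrow> w a < 0"
    if "a \<in> dimvecs" for a
    using slope_compare[OF Z that \<gamma>] unfolding w_def by (auto simp: not_le[symmetric])
  have dim: "x \<in> dimvecs" "y \<in> dimvecs" "set (y # zs) \<subseteq> dimvecs" using Cons.prems(1) by auto
  note IH = Cons.IH[OF dim(3) ne]
  show ?case
  proof (intro conjI impI)
    assume p: "0 \<le> p" "0 < w x"
    with flip have "\<not> slope Z y < slope Z x" by simp
    with pos[OF dim(1)] pos[OF dim(2)] p have "0 < w y" by linarith
    with IH p show "0 < p + w (sum_list (x # y # zs))" by (simp add: wadd add.assoc)
  next
    assume p: "p \<le> 0" "w x < 0"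
    with flip have "slope Z y < slope Z x" by simp
    with neg[OF dim(1)] neg[OF dim(2)] p have "w y < 0" by linarith
    with IH p show "p + w (sum_list (x # y # zs)) < 0" by (simp add: wadd add.assoc)
  qed
qed (simp add: w_def)

lemma reineke_comp_hn:
  assumes Z: "central_charge Z" and \<alpha>: "\<alpha> \<in> decomps \<gamma>"
  shows "coll_comp (reineke_coll Z) (hn_coll Z) \<alpha> = (if length \<alpha> = 1 then 1 else 0)"
proof -
  define w where "w = slope_excess Z \<gamma>"
  have \<gamma>: "\<gamma> \<in> dimvecs" using \<alpha> by (rule decomps_total)
  have w: "w (sum_list xs) = sum_list (map w xs)" for xs
    unfolding w_def by (rule slope_excess_sum_list[OF Z])
  have "reineke_coll Z (map sum_list bs) * prod_list (map (hn_coll Z) bs) = shifted_term Z w 0 bs"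
    if "bs \<in> splittings \<alpha>" for bs
  proof -
    have "map sum_list bs \<in> decomps \<gamma>"
      using that \<alpha> unfolding splittings_def decomps_def
      by (fastforce simp: sum_list_concat intro!: sum_list_dimvecs)
    from reineke_coll_eq[OF Z this \<gamma> refl] show ?thesis
      by (simp add: shifted_term_def w_def comp_def)
  qed
  then have eq: "coll_comp (reineke_coll Z) (hn_coll Z) \<alpha> = (\<Sum>bs\<in>splittings \<alpha>. shifted_term Z w 0 bs)"
    by (simp add: coll_comp_def)
  consider x where "\<alpha> = [x]" | x y zs where "\<alpha> = x # y # zs"
    using \<alpha> by (cases \<alpha> rule: remdups_adj.cases) (auto simp: decomps_def)
  then show ?thesis
  proof cases
    case 1
    then show ?thesis
      by (simp add: eq[unfolded 1] splittings_singleton shifted_term_def hn_coll_def slope_decreasing_def)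
  next
    case 2
    have dim: "set (x # y # zs) \<subseteq> dimvecs" "set (y # zs) \<subseteq> dimvecs" "x \<in> dimvecs" "y \<in> dimvecs"
      using \<alpha> 2 by (auto simp: decomps_def)
    have tot: "w (sum_list (x # y # zs)) = 0" using \<alpha> 2 by (auto simp: decomps_def w_def)
    have "(\<Sum>bs\<in>splittings \<alpha>. shifted_term Z w 0 bs) = 0"
    proof (rule ccontr)
      assume nz: "(\<Sum>bs\<in>splittings \<alpha>. shifted_term Z w 0 bs) \<noteq> 0"
      then have flip: "(slope Z y < slope Z x) \<noteq> (0 < w x)"
        and ne: "(\<Sum>bs\<in>splittings (y # zs). shifted_term Z w (0 + w x) bs) \<noteq> 0"
        unfolding 2 sum_shifted_term_Cons_Cons[OF w] by auto
      \<comment> \<open>If the first term lies above the total, the drift starts there; otherwise the slope drops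
        at the first place, so the second term lies below the total and the drift starts with it.\<close>
      show False
      proof (cases "0 < w x")
        case True
        then show False
          using shifted_terms_drift[OF Z \<gamma> dim(1)] nz tot unfolding 2 w_def by fastforce
      next
        case False
        with flip have less: "slope Z y < slope Z x" by simp
        have "slope Z x \<le> slope Z \<gamma>"
          using slope_less_iff[OF Z dim(3) \<gamma>] False by (simp add: w_def)
        with less slope_le_iff[OF Z dim(4) \<gamma>] have "w y < 0" by (simp add: w_def)
        then have "w x + w (sum_list (y # zs)) < 0"
          using shifted_terms_drift[OF Z \<gamma> dim(2) ne[unfolded w_def]] False by (simp add: w_def)
        then show False using tot w[of "[x, sum_list (y # zs)]"] by simp
      qed
    qed
    then have "coll_comp (reineke_coll Z) (hn_coll Z) \<alpha> = 0" using eq by simp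
    then show ?thesis using 2 by simp
  qed
qed

lemma successively_eq_iff:
  "successively (\<lambda>a b. f a = f b) (x # xs) \<longleftrightarrow> (\<forall>y\<in>set xs. f y = f x)"
  by (induction xs arbitrary: x) auto

text \<open>Each block contributes one sign fewer than its length, and the splitting contributes one sign
  fewer than the number of blocks; in total one sign is missing.\<close>

lemma signs_concat:
  fixes f :: "'a list \<Rightarrow> rat"
  assumes "\<forall>b\<in>set bs. b \<noteq> [] \<and> f b = (-1) ^ (length b - 1)" "bs \<noteq> []"
  shows "(-1) ^ (length bs - 1) * prod_list (map f bs) = (-1) ^ (length (concat bs) - 1)"
proof -
  have pred: "(-1) ^ (n - 1) = - ((-1) ^ n :: rat)" if "0 < n" for n :: nat
    using that by (cases n) simp_all
  have "(-1) ^ length bs * prod_list (map f bs) = (-1) ^ length (concat bs)"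
    using assms(1)
  proof (induction bs)
    case (Cons b bs)
    have b: "f b = - ((-1) ^ length b)" using Cons.prems pred[of "length b"] by simp
    have IH: "(-1) ^ length (concat bs) = (-1) ^ length bs * prod_list (map f bs)"
      using Cons.IH Cons.prems by simp
    show ?case by (simp add: b power_add IH mult.left_commute)
  qed simp
  moreover have "concat bs \<noteq> []"
  proof -
    obtain c cs where "bs = c # cs" using assms(2) by (cases bs) simp_all
    then show ?thesis using assms(1) by simp
  qed
  ultimately show ?thesis using assms(2) pred[of "length bs"] pred[of "length (concat bs)"] by simp
qed

text \<open>At most one splitting contributes: equality of the slopes of the block sums and the Reineke
  condition inside the blocks say together that every block is an excursion.\<close>

lemma log_comp_reineke:
  assumes Z: "central_charge Z" and \<alpha>: "\<alpha> \<in> decomps \<gamma>"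
  shows "coll_comp (log_coll Z) (reineke_coll Z) \<alpha> = g_Z Z \<alpha>"
proof -
  define w where "w = slope_excess Z \<gamma>"
  have \<gamma>: "\<gamma> \<in> dimvecs" using \<alpha> by (rule decomps_total)
  have w: "w (sum_list xs) = sum_list (map w xs)" for xs
    unfolding w_def by (rule slope_excess_sum_list[OF Z])
  have ne: "\<alpha> \<noteq> []" and tot: "sum_list \<alpha> = \<gamma>" using \<alpha> by (auto simp: decomps_def)
  let ?E = "\<lambda>bs. \<forall>b\<in>set bs. excursion (map w b)"
  have summand: "log_coll Z (map sum_list bs) * prod_list (map (reineke_coll Z) bs) =
      (if ?E bs then (-1) ^ (length \<alpha> - 1) / of_nat (length bs) else 0)"
    if bs: "bs \<in> splittings \<alpha>" for bs
  proof -
    have cat: "concat bs = \<alpha>" using bs by (simp add: splittings_def)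
    have dec: "b \<in> decomps (sum_list b)" "sum_list b \<in> dimvecs" if "b \<in> set bs" for b
    proof -
      have "b \<noteq> []" using bs that by (auto simp: splittings_def)
      moreover have "set b \<subseteq> set \<alpha>" using cat that by auto
      ultimately show "b \<in> decomps (sum_list b)" using \<alpha> by (auto simp: decomps_def)
      then show "sum_list b \<in> dimvecs" by (rule decomps_total)
    qed
    have sl: "slope Z (sum_list b) = slope Z \<gamma> \<longleftrightarrow> sum_list (map w b) = 0" if "b \<in> set bs" for b
      using slope_eq_iff[OF Z dec(2)[OF that] \<gamma>] by (simp add: w_def flip: slope_excess_sum_list[OF Z])
    have ex: "excursion (map w b) \<longleftrightarrow> slope Z (sum_list b) = slope Z \<gamma> \<and> reineke_coll Z b \<noteq> 0"
      if "b \<in> set bs" for b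
      using reineke_coll_eq[OF Z dec(1)[OF that] \<gamma>] sl[OF that] dec(1)[OF that]
      by (auto simp: excursion_def w_def decomps_def split: if_splits)
    show ?thesis
    proof (cases "?E bs")
      case True
      have "successively (\<lambda>a b. slope Z a = slope Z b) (map sum_list bs)"
        using True ex by (cases bs) (simp, auto simp: successively_eq_iff simp del: successively.simps)
      moreover have "bs \<noteq> []" using ne cat by auto
      moreover have "\<forall>b\<in>set bs. b \<noteq> [] \<and> reineke_coll Z b = (-1) ^ (length b - 1)"
      proof
        fix b assume b: "b \<in> set bs"
        then have "excursion (map w b)" using True by blast
        then show "b \<noteq> [] \<and> reineke_coll Z b = (-1) ^ (length b - 1)"
          using ex[OF b] excursion_map_nonempty by (simp add: reineke_coll_def split: if_splits)
      qed
      then have "(-1) ^ (length bs - 1) * prod_list (map (reineke_coll Z) bs) = (-1) ^ (length \<alpha> - 1)"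
        using signs_concat[of bs "reineke_coll Z"] \<open>bs \<noteq> []\<close> by (simp add: cat)
      ultimately show ?thesis using True by (simp add: log_coll_def cat)
    next
      case False
      have "log_coll Z (map sum_list bs) = 0 \<or> 0 \<in> set (map (reineke_coll Z) bs)"
      proof (rule ccontr)
        assume *: "\<not> ?thesis"
        then have log: "successively (\<lambda>a b. slope Z a = slope Z b) (map sum_list bs)"
          by (auto simp: log_coll_def split: if_splits)
        obtain c cs where c: "bs = c # cs" using ne cat by (cases bs) auto
        have cd: "sum_list c \<in> dimvecs" using dec(2) c by auto
        have all: "slope Z (sum_list b) = slope Z (sum_list c)" if "b \<in> set bs" for b
          using log that unfolding c list.map successively_eq_iff by auto
        have "slope_excess Z (sum_list c) (sum_list b) = 0" if "b \<in> set bs" for b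
          using all[OF that] slope_eq_iff[OF Z dec(2)[OF that] cd] by simp
        then have "slope_excess Z (sum_list c) (sum_list (map sum_list bs)) = 0"
          by (simp add: slope_excess_sum_list[OF Z, of _ "map sum_list bs"] comp_def
              cong: map_cong)
        \<comment> \<open>All block sums have the slope of the first one, hence so does their total.\<close>
        moreover have "sum_list (map sum_list bs) = \<gamma>"
          using cat tot by (simp flip: sum_list_concat)
        ultimately have "slope Z \<gamma> = slope Z (sum_list c)"
          using slope_eq_iff[OF Z \<gamma> cd] by simp
        then have "?E bs" using all ex * by force
        with False show False by blast
      qed
      then show ?thesis using False by (auto simp: prod_list_zero_iff)
    qed
  qed
  have "coll_comp (log_coll Z) (reineke_coll Z) \<alpha> =
      (\<Sum>bs | bs \<in> splittings \<alpha> \<and> ?E bs. (-1) ^ (length \<alpha> - 1) / of_nat (length bs))"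
    unfolding coll_comp_def
    by (simp add: summand sum.inter_filter[OF finite_splittings] del: One_nat_def cong: sum.cong)
  also have "\<dots> = (-1) ^ (length \<alpha> - 1) * level_weight (map w \<alpha>)"
  proof (cases "\<forall>s\<in>set (prefix_sums (map w \<alpha>)). 0 \<le> s")
    case True
    have "sum_list (map w \<alpha>) = 0" unfolding w[symmetric] tot by (simp add: w_def)
    from excursions_exist[OF this True] obtain bs where bs: "concat bs = \<alpha>" "?E bs" by blast
    then have "bs \<in> splittings \<alpha>" using excursion_map_nonempty by (auto simp: splittings_def)
    moreover have "cs = bs" if "cs \<in> splittings \<alpha>" "?E cs" for cs
      using excursions_unique[of cs w bs] that bs by (simp add: splittings_def)
    ultimately have "{bs. bs \<in> splittings \<alpha> \<and> ?E bs} = {bs}" using bs(2) by blast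
    moreover have "count_list (prefix_sums (map w \<alpha>)) 0 = length bs"
      using excursions_concat(3)[of "map (map w) bs"] bs by (simp add: map_concat[symmetric])
    ultimately show ?thesis using True by (simp add: level_weight_def)
  next
    case False
    have "\<not> ?E bs" if "concat bs = \<alpha>" for bs
      using excursions_concat(2)[of "map (map w) bs"] False unfolding map_concat[symmetric] that by auto
    then have empty: "{bs. bs \<in> splittings \<alpha> \<and> ?E bs} = {}" by (auto simp: splittings_def)
    show ?thesis using False unfolding empty by (auto simp: level_weight_def)
  qed
  also have "\<dots> = g_Z Z \<alpha>" by (simp add: g_Z_eq[OF Z \<alpha>] w_def)
  finally show ?thesis .
qed

context graded_rat_algebra begin

lemma act_hn_coll: "\<gamma> \<in> dimvecs \<Longrightarrow> act smul (hn_coll Z) (hn_inv Z A) \<gamma> = A \<gamma>"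
  using finite_decomps[of \<gamma>]
  by (simp add: act_def hn_coll_def hn_recursion[of \<gamma> A Z] sum.inter_filter if_distribR if_distrib
      cong: if_cong)

lemma hn_inv_eq_act:
  assumes Z: "central_charge Z" and \<gamma>: "\<gamma> \<in> dimvecs"
  shows "hn_inv Z A \<gamma> = act smul (reineke_coll Z) A \<gamma>"
proof -
  have "act smul (reineke_coll Z) A \<gamma> = act smul (reineke_coll Z) (act smul (hn_coll Z) (hn_inv Z A)) \<gamma>"
    by (rule act_cong) (simp_all add: act_hn_coll)
  also have "\<dots> = hn_inv Z A \<gamma>"
    unfolding act_act by (rule act_identity[OF \<gamma>]) (rule reineke_comp_hn[OF Z])
  finally show ?thesis by simp
qed

lemma inv_bar_eq_act:
  assumes Z: "central_charge Z"
  shows "inv_bar smul A Z \<gamma> = act smul (g_Z Z) A \<gamma>"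
proof -
  have "inv_bar smul A Z \<gamma> = act smul (log_coll Z) (act smul (reineke_coll Z) A) \<gamma>"
    unfolding inv_bar_def by (rule act_cong) (simp_all add: hn_inv_eq_act[OF Z])
  also have "\<dots> = act smul (g_Z Z) A \<gamma>"
    unfolding act_act by (rule act_cong) (simp_all add: log_comp_reineke[OF Z])
  finally show ?thesis .
qed

end

section \<open>Averaging over rotations\<close>

lemma sum_rotate:
  assumes fin: "finite X" and cl: "\<And>bs. bs \<in> X \<Longrightarrow> rotate1 bs \<in> X"
  shows "(\<Sum>bs\<in>X. h (rotate j bs)) = (\<Sum>bs\<in>X. h bs)"
proof -
  have "inj_on rotate1 X"
  proof (rule inj_onI)
    fix xs ys :: "'a list" assume "rotate1 xs = rotate1 ys"
    then show "xs = ys" by (cases xs; cases ys) auto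
  qed
  moreover have "rotate1 ` X \<subseteq> X" using cl by auto
  ultimately have bij: "bij_betw rotate1 X X"
    using endo_inj_surj[OF fin] by (auto simp: bij_betw_def)
  have "(\<Sum>bs\<in>X. h (rotate (Suc j) bs)) = (\<Sum>bs\<in>X. h (rotate j bs))" for j
    using sum.reindex_bij_betw[OF bij, of "\<lambda>bs. h (rotate j bs)"]
    by (simp add: rotate1_rotate_swap)
  then show ?thesis by (induction j) simp_all
qed

text \<open>Each summand on the right is spread evenly over the rotations of its index, and the resulting
  double sum is reorganised by the rotated index.\<close>

lemma (in vector_space) sum_rotation_average:
  fixes Q :: "'c list \<Rightarrow> 'b" and c :: "'c list \<Rightarrow> 'a"
  assumes fin: "finite X" and cl: "\<And>bs. bs \<in> X \<Longrightarrow> rotate1 bs \<in> X"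
    and Q: "\<And>bs. bs \<in> X \<Longrightarrow> Q (rotate1 bs) = Q bs"
    and c: "\<And>bs. bs \<in> X \<Longrightarrow> (\<Sum>j<length bs. c (rotate j bs)) = 1"
    and len: "\<And>bs. bs \<in> X \<Longrightarrow> of_nat (length bs) \<noteq> (0 :: 'a)"
  shows "(\<Sum>bs\<in>X. scale (c bs) (Q bs)) = (\<Sum>bs\<in>X. scale (1 / of_nat (length bs)) (Q bs))"
proof -
  obtain N where N: "\<And>bs. bs \<in> X \<Longrightarrow> length bs \<le> N"
    using finite_nat_set_iff_bounded_le[of "length ` X"] fin by auto
  \<comment> \<open>The number of rotations depends on the list. Padding with zeros up to a common bound \<open>N\<close>
    allows the two sums to be exchanged.\<close>
  define h where "h j bs = (if j < length bs then scale (1 / of_nat (length bs) * c bs) (Q bs) else 0)"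
    for j bs
  have trunc: "(\<Sum>j<length bs. f j) = (\<Sum>j<N. if j < length bs then f j else 0)"
    if "bs \<in> X" for bs and f :: "nat \<Rightarrow> 'b"
  proof -
    have "{..<N} \<inter> {j. j < length bs} = {..<length bs}" using N[OF that] by auto
    then show ?thesis by (simp add: sum.If_cases)
  qed
  have X: "rotate j bs \<in> X" if "bs \<in> X" for j bs
    using that cl by (induction j) auto
  have Qj: "Q (rotate j bs) = Q bs" if "bs \<in> X" for j bs
    using that Q X by (induction j) auto
  have "(\<Sum>bs\<in>X. scale (1 / of_nat (length bs)) (Q bs)) =
      (\<Sum>bs\<in>X. \<Sum>j<length bs. scale (1 / of_nat (length bs) * c (rotate j bs)) (Q bs))"
  proof (rule sum.cong)
    fix bs assume "bs \<in> X"
    from c[OF this] show "scale (1 / of_nat (length bs)) (Q bs) =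
        (\<Sum>j<length bs. scale (1 / of_nat (length bs) * c (rotate j bs)) (Q bs))"
      unfolding scale_sum_left[symmetric] sum_distrib_left[symmetric] by simp
  qed simp
  also have "\<dots> = (\<Sum>bs\<in>X. \<Sum>j<N. h j (rotate j bs))"
  proof (rule sum.cong)
    fix bs assume bs: "bs \<in> X"
    show "(\<Sum>j<length bs. scale (1 / of_nat (length bs) * c (rotate j bs)) (Q bs)) =
        (\<Sum>j<N. h j (rotate j bs))"
      unfolding trunc[OF bs] by (auto simp: h_def Qj[OF bs] intro!: sum.cong)
  qed simp
  also have "\<dots> = (\<Sum>j<N. \<Sum>bs\<in>X. h j (rotate j bs))" by (rule sum.swap)
  also have "\<dots> = (\<Sum>j<N. \<Sum>bs\<in>X. h j bs)" by (simp add: sum_rotate[OF fin cl])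
  also have "\<dots> = (\<Sum>bs\<in>X. \<Sum>j<N. h j bs)" by (rule sum.swap)
  also have "\<dots> = (\<Sum>bs\<in>X. \<Sum>j<length bs. scale (1 / of_nat (length bs) * c bs) (Q bs))"
    by (rule sum.cong) (simp_all add: trunc[symmetric] h_def)
  also have "\<dots> = (\<Sum>bs\<in>X. scale (c bs) (Q bs))"
    using len by (intro sum.cong refl) (simp flip: scale_sum_left)
  finally show ?thesis by simp
qed

text \<open>How the weights near a limit relate to the limiting weight: strict signs persist, and only where
  the limiting weight vanishes is there no constraint.\<close>

definition sign_refines :: "real list \<Rightarrow> real list \<Rightarrow> bool" where
  "sign_refines us vs \<longleftrightarrow> list_all2 (\<lambda>x y. (0 < x \<longrightarrow> 0 < y) \<and> (x < 0 \<longrightarrow> y < 0)) us vs"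

text \<open>Strictly inside a block the \<open>v\<close>-prefix sums are positive, hence so are the \<open>w\<close>-prefix sums; the
  nonpositive ones can only occur at block boundaries. The offset \<open>p\<close> is the \<open>w\<close>-weight of the
  preceding blocks, whose \<open>v\<close>-weight is zero.\<close>

lemma filter_prefix_sums_blocks:
  assumes "\<forall>b\<in>set bs. excursion (map v b)"
    and "list_all2 (\<lambda>x y. 0 < x \<longrightarrow> 0 < y)
      (prefix_sums (map v (concat bs))) (map ((+) p) (prefix_sums (map w (concat bs))))"
  shows "filter (\<lambda>s. s \<le> 0) (map ((+) p) (prefix_sums (map w (concat bs)))) =
    filter (\<lambda>s. s \<le> 0) (map ((+) p) (prefix_sums (map (\<lambda>b. sum_list (map w b)) bs)))"
  using assms
proof (induction bs arbitrary: p)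
  case (Cons b bs)
  have ex: "excursion (map v b)" using Cons.prems(1) by simp
  then obtain x xs where b: "b = x # xs" using excursion_map_nonempty[OF ex] by (cases b) auto
  have zero: "sum_list (map v b) = 0" using ex by (simp add: excursion_def)
  let ?W = "sum_list (map w b)"
  have split: "prefix_sums (map v (concat (b # bs))) =
      prefix_sums (map v b) @ prefix_sums (map v (concat bs))"
    "map ((+) p) (prefix_sums (map w (concat (b # bs)))) =
      map ((+) p) (prefix_sums (map w b)) @ map ((+) (p + ?W)) (prefix_sums (map w (concat bs)))"
    by (simp_all add: prefix_sums_append zero map_idI comp_def add.assoc)
  have first: "list_all2 (\<lambda>x y. 0 < x \<longrightarrow> 0 < y) (prefix_sums (map v b)) (map ((+) p) (prefix_sums (map w b)))"
    and rest: "list_all2 (\<lambda>x y. 0 < x \<longrightarrow> 0 < y) (prefix_sums (map v (concat bs)))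
      (map ((+) (p + ?W)) (prefix_sums (map w (concat bs))))"
    using Cons.prems(2) unfolding split by (simp_all add: list_all2_append)
  have IH: "filter (\<lambda>s. s \<le> 0) (map ((+) (p + ?W)) (prefix_sums (map w (concat bs)))) =
      filter (\<lambda>s. s \<le> 0) (map ((+) (p + ?W)) (prefix_sums (map (\<lambda>b. sum_list (map w b)) bs)))"
    using Cons.IH[OF _ rest] Cons.prems(1) by simp
  have pos: "0 < s" if "s \<in> set (tl (prefix_sums (map v b)))" for s
    using ex that by (simp add: excursion_def)
  have "0 < s" if s: "s \<in> set (tl (map ((+) p) (prefix_sums (map w b))))" for s
  proof -
    have "list_all2 (\<lambda>x y. 0 < x \<longrightarrow> 0 < y) (tl (prefix_sums (map v b))) (tl (map ((+) p) (prefix_sums (map w b))))"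
      using first by (simp add: b)
    then obtain r where "r \<in> set (tl (prefix_sums (map v b)))" "0 < r \<longrightarrow> 0 < s"
      using s unfolding list_all2_iff by (metis in_set_zipE in_set_impl_in_set_zip2 case_prodD)
    with pos show ?thesis by blast
  qed
  then have "filter (\<lambda>s. s \<le> 0) (tl (map ((+) p) (prefix_sums (map w b)))) = []"
    by (force simp: filter_empty_conv)
  then have "filter (\<lambda>s. s \<le> 0) (map ((+) p) (prefix_sums (map w b))) = filter (\<lambda>s. s \<le> 0) [p]"
    by (simp add: b)
  moreover have "map ((+) p) (prefix_sums (map (\<lambda>b. sum_list (map w b)) (b # bs))) =
      [p] @ map ((+) (p + ?W)) (prefix_sums (map (\<lambda>b. sum_list (map w b)) bs))"
    by (simp add: comp_def add.assoc)
  ultimately show ?case by (simp only: split filter_append IH)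
qed simp

text \<open>Positive prefix sums neither violate the sign condition nor contribute to the count of zeros.\<close>

lemma level_weight_cong:
  assumes "filter (\<lambda>s. s \<le> 0) (prefix_sums us) = filter (\<lambda>s. s \<le> 0) (prefix_sums vs)"
  shows "level_weight us = level_weight vs"
proof -
  have nonneg: "(\<forall>s\<in>set xs. 0 \<le> s) \<longleftrightarrow> (\<forall>s\<in>set (filter (\<lambda>s. s \<le> 0) xs). 0 \<le> s)" for xs :: "real list"
    by (auto simp: linorder_not_less[symmetric])
  have count: "count_list xs 0 = count_list (filter (\<lambda>s. s \<le> 0) xs) 0" for xs :: "real list"
    by (induction xs) auto
  show ?thesis
    unfolding level_weight_def by (simp only: nonneg[of "prefix_sums _"] count[of "prefix_sums _"] assms)
qed

lemma level_weight_blocks: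
  assumes "\<forall>b\<in>set bs. excursion (map v b)"
    and "sign_refines (prefix_sums (map v (concat bs))) (prefix_sums (map w (concat bs)))"
  shows "level_weight (map w (concat bs)) = level_weight (map (\<lambda>b. sum_list (map w b)) bs)"
proof (rule level_weight_cong)
  have id: "map ((+) 0) us = us" for us :: "real list" by (simp add: map_idI)
  have "list_all2 (\<lambda>x y. 0 < x \<longrightarrow> 0 < y) (prefix_sums (map v (concat bs))) (prefix_sums (map w (concat bs)))"
    using assms(2) unfolding sign_refines_def by (rule list_all2_mono) blast
  then show "filter (\<lambda>s. s \<le> 0) (prefix_sums (map w (concat bs))) =
      filter (\<lambda>s. s \<le> 0) (prefix_sums (map (\<lambda>b. sum_list (map w b)) bs))"
    using filter_prefix_sums_blocks[OF assms(1), of 0 w] unfolding id by simp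
qed

definition excursion_blocks :: "(nat ^ 'r::finite \<Rightarrow> real) \<Rightarrow> nat ^ 'r \<Rightarrow> (nat ^ 'r) list list set" where
  "excursion_blocks v \<gamma> = {bs. concat bs \<in> decomps \<gamma> \<and> (\<forall>b\<in>set bs. excursion (map v b))}"

lemma bij_betw_concat_excursion_blocks:
  assumes v: "\<And>xs. v (sum_list xs) = sum_list (map v xs)" and \<gamma>: "v \<gamma> = 0"
  shows "bij_betw concat (excursion_blocks v \<gamma>)
    {\<alpha> \<in> decomps \<gamma>. \<forall>s\<in>set (prefix_sums (map v \<alpha>)). 0 \<le> s}"
  unfolding bij_betw_def
proof (intro conjI equalityI subsetI)
  show "inj_on concat (excursion_blocks v \<gamma>)"
    by (rule inj_onI) (auto simp: excursion_blocks_def intro: excursions_unique[of _ v])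
next
  fix \<alpha> assume "\<alpha> \<in> concat ` excursion_blocks v \<gamma>"
  then obtain bs where bs: "\<alpha> = concat bs" "concat bs \<in> decomps \<gamma>" "\<forall>b\<in>set bs. excursion (map v b)"
    by (auto simp: excursion_blocks_def)
  then have "\<forall>s\<in>set (prefix_sums (map v \<alpha>)). 0 \<le> s"
    using excursions_concat(2)[of "map (map v) bs"] by (simp add: map_concat)
  with bs show "\<alpha> \<in> {\<alpha> \<in> decomps \<gamma>. \<forall>s\<in>set (prefix_sums (map v \<alpha>)). 0 \<le> s}" by simp
next
  fix \<alpha> assume \<alpha>: "\<alpha> \<in> {\<alpha> \<in> decomps \<gamma>. \<forall>s\<in>set (prefix_sums (map v \<alpha>)). 0 \<le> s}"
  then have "sum_list (map v \<alpha>) = 0" using \<gamma> by (simp add: decomps_def flip: v)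
  with \<alpha> excursions_exist[of v \<alpha>] obtain bs where "concat bs = \<alpha>" "\<forall>b\<in>set bs. excursion (map v b)"
    by auto
  with \<alpha> show "\<alpha> \<in> concat ` excursion_blocks v \<gamma>" by (auto simp: excursion_blocks_def)
qed

context graded_rat_algebra begin

lemma ordered_prod_graded:
  assumes "xs \<noteq> []" "\<And>x. x \<in> set xs \<Longrightarrow> H x \<in> R x"
  shows "ordered_prod (map H xs) \<in> R (sum_list xs)"
  using assms by (induction xs rule: induct_list012) (auto intro: graded_mult)

text \<open>The right-hand side does not mention \<open>w\<close>. Applying this to two weights, one of which may be \<open>v\<close>
  itself, shows that they define the same element of degree \<open>\<gamma>\<close>.\<close>

lemma sum_level_weight_rotation_invariant:
  fixes v w :: "nat ^ 'r \<Rightarrow> real" and H :: "nat ^ 'r \<Rightarrow> 'a"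
  assumes v: "\<And>xs. v (sum_list xs) = sum_list (map v xs)" and v\<gamma>: "v \<gamma> = 0"
    and w: "\<And>xs. w (sum_list xs) = sum_list (map w xs)" and w\<gamma>: "w \<gamma> = 0"
    and refines: "\<And>\<alpha>. \<alpha> \<in> decomps \<gamma> \<Longrightarrow> sign_refines (prefix_sums (map v \<alpha>)) (prefix_sums (map w \<alpha>))"
    and H: "\<And>a. a \<in> dimvecs \<Longrightarrow> H a \<in> R a"
    and comm: "\<And>a b x y. a + b = \<gamma> \<Longrightarrow> v a = 0 \<Longrightarrow> x \<in> R a \<Longrightarrow> y \<in> R b \<Longrightarrow> x * y = y * x"
  shows "act smul (\<lambda>\<alpha>. (-1) ^ (length \<alpha> - 1) * level_weight (map w \<alpha>)) H \<gamma> =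
    (\<Sum>bs\<in>excursion_blocks v \<gamma>. smul (1 / of_nat (length bs))
      (smul ((-1) ^ (length (concat bs) - 1)) (ordered_prod (map H (concat bs)))))"
proof -
  let ?D = "{\<alpha> \<in> decomps \<gamma>. \<forall>s\<in>set (prefix_sums (map v \<alpha>)). 0 \<le> s}"
  let ?X = "excursion_blocks v \<gamma>"
  define P where "P \<alpha> = smul ((-1) ^ (length \<alpha> - 1)) (ordered_prod (map H \<alpha>))" for \<alpha>
  define c where "c bs = level_weight (map (\<lambda>b. w (sum_list b)) bs)" for bs
  have bij: "bij_betw concat ?X ?D" by (rule bij_betw_concat_excursion_blocks[OF v v\<gamma>])
  have fin: "finite ?X"
    using bij_betw_finite[OF bij] finite_decomps[of \<gamma>] by simp
  have nonempty: "bs \<noteq> []" "concat bs \<noteq> []" if "bs \<in> ?X" for bs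
    using that by (auto simp: excursion_blocks_def decomps_def)
  have zero: "level_weight (map w \<alpha>) = 0" if \<alpha>: "\<alpha> \<in> decomps \<gamma> - ?D" for \<alpha>
  proof -
    have "list_all2 (\<lambda>x y. (0 < x \<longrightarrow> 0 < y) \<and> (x < 0 \<longrightarrow> y < 0)) (prefix_sums (map v \<alpha>)) (prefix_sums (map w \<alpha>))"
      using refines[of \<alpha>] \<alpha> by (simp add: sign_refines_def)
    moreover obtain s where "s \<in> set (prefix_sums (map v \<alpha>))" "s < 0"
      using \<alpha> by (auto simp: not_le)
    ultimately obtain t where "t \<in> set (prefix_sums (map w \<alpha>))" "t < 0"
      unfolding list_all2_conv_all_nth in_set_conv_nth by metis
    then show ?thesis by (auto simp: level_weight_def not_le)
  qed
  have "act smul (\<lambda>\<alpha>. (-1) ^ (length \<alpha> - 1) * level_weight (map w \<alpha>)) H \<gamma> =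
      (\<Sum>\<alpha>\<in>decomps \<gamma>. smul (level_weight (map w \<alpha>)) (P \<alpha>))"
    by (simp add: act_def P_def mult.commute)
  also have "\<dots> = (\<Sum>\<alpha>\<in>?D. smul (level_weight (map w \<alpha>)) (P \<alpha>))"
    by (rule sum.mono_neutral_right) (use zero finite_decomps in auto)
  also have "\<dots> = (\<Sum>bs\<in>?X. smul (level_weight (map w (concat bs))) (P (concat bs)))"
    by (rule sum.reindex_bij_betw[OF bij, symmetric])
  also have "\<dots> = (\<Sum>bs\<in>?X. smul (c bs) (P (concat bs)))"
  proof (intro sum.cong refl arg_cong2[where f = smul])
    fix bs assume "bs \<in> ?X"
    then show "level_weight (map w (concat bs)) = c bs"
      using level_weight_blocks[of bs v w] refines by (simp add: excursion_blocks_def c_def w)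
  qed
  also have "\<dots> = (\<Sum>bs\<in>?X. smul (1 / of_nat (length bs)) (P (concat bs)))"
  proof (rule sum_rotation_average[OF fin])
    fix bs assume bs: "bs \<in> ?X"
    obtain b cs where b: "bs = b # cs" using nonempty(1)[OF bs] by (cases bs) auto
    have dim: "set (concat bs) \<subseteq> dimvecs" and tot: "sum_list (concat bs) = \<gamma>"
      and ex: "\<forall>b\<in>set bs. excursion (map v b)"
      using bs by (simp_all add: excursion_blocks_def decomps_def)
    have "sum_list (concat (rotate1 bs)) = \<gamma>" using tot by (simp add: b add.commute)
    then show "rotate1 bs \<in> ?X"
      using dim ex nonempty(2)[OF bs] by (auto simp: excursion_blocks_def decomps_def b)
    show "P (concat (rotate1 bs)) = P (concat bs)"
    proof (cases "concat cs = []")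
      case False
      have b_ne: "b \<noteq> []" using ex b excursion_map_nonempty by auto
      have "sum_list b + sum_list (concat cs) = \<gamma>" using tot by (simp add: b)
      moreover have "v (sum_list b) = 0" using ex by (simp add: b v excursion_def)
      moreover have "ordered_prod (map H b) \<in> R (sum_list b)"
        by (rule ordered_prod_graded[OF b_ne]) (use dim H in \<open>auto simp: b\<close>)
      moreover have "ordered_prod (map H (concat cs)) \<in> R (sum_list (concat cs))"
        by (rule ordered_prod_graded[OF False]) (use dim H in \<open>auto simp: b\<close>)
      ultimately have "ordered_prod (map H b) * ordered_prod (map H (concat cs)) =
          ordered_prod (map H (concat cs)) * ordered_prod (map H b)"
        by (rule comm)
      then show ?thesis using b_ne False
        by (simp add: P_def b ordered_prod_append add.commute)
    next
      case True
      then have "concat (rotate1 bs) = concat bs"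
        unfolding b rotate1.simps concat.simps concat_append True by simp
      then show ?thesis by simp
    qed
    have "sum_list (map (\<lambda>b. w (sum_list b)) bs) = 0"
      using tot w[of "map sum_list bs"] w\<gamma> by (simp add: sum_list_concat comp_def)
    then show "(\<Sum>j<length bs. c (rotate j bs)) = 1"
      using sum_level_weight_rotate[of "map (\<lambda>b. w (sum_list b)) bs"] nonempty(1)[OF bs]
      by (simp add: c_def rotate_map)
    show "of_nat (length bs) \<noteq> (0 :: rat)" using nonempty(1)[OF bs] by simp
  qed
  finally show ?thesis by (simp add: P_def)
qed

end

section \<open>Attractor invariants\<close>

text \<open>The counterpart of \<open>slope_excess\<close> for \<open>g_star\<close>. As the form is skew, pairing a part of \<open>\<gamma>\<close> with the
  rest amounts to pairing it with \<open>\<gamma>\<close>, which is additive in the part.\<close>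

definition pairing_weight :: "(int ^ 'r::finite \<Rightarrow> int ^ 'r \<Rightarrow> int) \<Rightarrow> nat ^ 'r \<Rightarrow> nat ^ 'r \<Rightarrow> real" where
  "pairing_weight B \<gamma> a = of_int (B (to_int_vec a) (to_int_vec \<gamma>))"

lemma skew_bilinear_formD:
  assumes "skew_bilinear_form B"
  shows "B (x + y) z = B x z + B y z" "B x (y + z) = B x y + B x z" "B x x = 0" "B 0 x = 0"
proof -
  note D = assms[unfolded skew_bilinear_form_def]
  show add: "B (x + y) z = B x z + B y z" for x y z using D by blast
  show "B x (y + z) = B x y + B x z" using D by blast
  have "B x x = - B x x" using D[THEN conjunct2, THEN conjunct2] by (elim allE)
  then show "B x x = 0" by simp
  show "B 0 x = 0" using add[of 0 0 x] by simp
qed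

lemma pairing_weight_sum_list:
  assumes "skew_bilinear_form B"
  shows "pairing_weight B \<gamma> (sum_list xs) = sum_list (map (pairing_weight B \<gamma>) xs)"
  by (induction xs)
    (simp_all add: pairing_weight_def to_int_vec_add to_int_vec_zero skew_bilinear_formD[OF assms])

lemma pairing_weight_add:
  assumes "skew_bilinear_form B"
  shows "pairing_weight B (a + b) a = of_int (B (to_int_vec a) (to_int_vec b))"
  by (simp add: pairing_weight_def to_int_vec_add skew_bilinear_formD[OF assms])

lemma g_star_eq:
  assumes "skew_bilinear_form B" "\<alpha> \<in> decomps \<gamma>"
  shows "g_star B \<alpha> = (-1) ^ (length \<alpha> - 1) * level_weight (map (pairing_weight B \<gamma>) \<alpha>)"
proof -
  have "pairing_weight B \<gamma> (sum_list (take k \<alpha>)) =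
      of_int (B (to_int_vec (sum_list (take k \<alpha>))) (to_int_vec (sum_list (drop k \<alpha>))))"
    if "k \<in> {1..<length \<alpha>}" for k
    using decomps_take_drop(3)[OF assms(2) that] pairing_weight_add[OF assms(1)] by metis
  moreover have "\<alpha> \<noteq> []" using assms(2) by (simp add: decomps_def)
  ultimately show ?thesis
    unfolding g_star_def
    by (intro signed_level_weight_eq[OF pairing_weight_sum_list[OF assms(1)]]) simp_all
qed

lemma central_charge_charge_of: "central_charge (charge_of \<theta>)"
  by (simp add: central_charge_def charge_of_def complex_eq_iff sum.distrib distrib_left axis_def
      if_distrib[of real_of_int] cong: if_cong)

lemma Re_charge_of_attractor:
  assumes "skew_bilinear_form B"
  shows "Re (charge_of (attractor_stability B \<gamma>) (to_int_vec a)) = - pairing_weight B \<gamma> a"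
proof -
  note B = skew_bilinear_formD[OF assms]
  have scale: "B (of_nat n *s x) z = of_nat n * B x z" for n x z
    by (induction n) (simp_all add: B vector_sadd_rdistrib algebra_simps)
  have sum: "B (sum f S) z = (\<Sum>k\<in>S. B (f k) z)" if "finite S" for f :: "'a \<Rightarrow> int ^ 'a" and S z
    using that by (induction S rule: finite_induct) (simp_all add: B)
  have "to_int_vec a = (\<Sum>k\<in>UNIV. of_nat (a $ k) *s axis k 1)"
    using basis_expansion[of "to_int_vec a"] by (simp add: to_int_vec_def)
  then have "B (to_int_vec a) (to_int_vec \<gamma>) =
      (\<Sum>k\<in>UNIV. of_nat (a $ k) * B (axis k 1) (to_int_vec \<gamma>))"
    using sum[of UNIV "\<lambda>k. of_nat (a $ k) *s axis k 1"] scale by simp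
  then show ?thesis
    by (simp add: pairing_weight_def charge_of_def attractor_stability_def to_int_vec_def[of a] mult.commute)
qed

text \<open>Only finitely many vectors occur as partial sums, and for each of them the slope excess is
  continuous in the stability parameter.\<close>

lemma eventually_sign_refines:
  assumes B: "skew_bilinear_form B" and \<gamma>: "\<gamma> \<in> dimvecs"
  shows "\<forall>\<^sub>F \<theta> in nhds (attractor_stability B \<gamma>). \<forall>\<alpha>\<in>decomps \<gamma>.
    sign_refines (prefix_sums (map (pairing_weight B \<gamma>) \<alpha>))
      (prefix_sums (map (slope_excess (charge_of \<theta>) \<gamma>) \<alpha>))"
proof -
  let ?\<theta> = "attractor_stability B \<gamma>" and ?v = "pairing_weight B \<gamma>"
  define r where "r = Im (charge_of ?\<theta> (to_int_vec \<gamma>))"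
  have r: "0 < r" unfolding r_def by (rule central_charge_Im_pos[OF central_charge_charge_of \<gamma>])
  \<comment> \<open>Since \<open>\<langle>\<gamma>,\<gamma>\<rangle> = 0\<close>, the vector \<open>\<gamma>\<close> has slope zero at the limit.\<close>
  have val: "slope_excess (charge_of ?\<theta>) \<gamma> a = ?v a * r" for a
    using Re_charge_of_attractor[OF B, of \<gamma> a] Re_charge_of_attractor[OF B, of \<gamma> \<gamma>]
    by (simp add: slope_excess_def r_def pairing_weight_def skew_bilinear_formD[OF B])
  have lim: "((\<lambda>\<theta>. slope_excess (charge_of \<theta>) \<gamma> a) \<longlongrightarrow> ?v a * r) (nhds ?\<theta>)" for a
    unfolding val[symmetric] slope_excess_def charge_of_def complex.sel
    by (intro tendsto_intros filterlim_ident)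
  have "\<forall>\<^sub>F \<theta> in nhds ?\<theta>. (0 < ?v a \<longrightarrow> 0 < slope_excess (charge_of \<theta>) \<gamma> a) \<and>
      (?v a < 0 \<longrightarrow> slope_excess (charge_of \<theta>) \<gamma> a < 0)" for a
  proof (cases "?v a" "0 :: real" rule: linorder_cases)
    case less
    then have "\<forall>\<^sub>F \<theta> in nhds ?\<theta>. slope_excess (charge_of \<theta>) \<gamma> a < 0"
      using r by (intro order_tendstoD(2)[OF lim]) (simp add: mult_less_0_iff)
    then show ?thesis by eventually_elim (use less in auto)
  next
    case greater
    then have "\<forall>\<^sub>F \<theta> in nhds ?\<theta>. 0 < slope_excess (charge_of \<theta>) \<gamma> a"
      using r by (intro order_tendstoD(1)[OF lim]) simp
    then show ?thesis by eventually_elim (use greater in auto)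
  qed simp
  then have "\<forall>\<^sub>F \<theta> in nhds ?\<theta>. \<forall>a\<in>{a. vtotal a \<le> vtotal \<gamma>}.
      (0 < ?v a \<longrightarrow> 0 < slope_excess (charge_of \<theta>) \<gamma> a) \<and>
      (?v a < 0 \<longrightarrow> slope_excess (charge_of \<theta>) \<gamma> a < 0)"
    by (intro eventually_ball_finite finite_vtotal_le) blast
  then show ?thesis
  proof eventually_elim
    case (elim \<theta>)
    show ?case
    proof
      fix \<alpha> assume "\<alpha> \<in> decomps \<gamma>"
      then have "vtotal (sum_list (take k \<alpha>)) \<le> vtotal \<gamma>" for k
        by (metis (mono_tags, lifting) append_take_drop_id decomps_def le_add1 mem_Collect_eq
            sum_list_append vtotal_add)
      with elim show "sign_refines (prefix_sums (map ?v \<alpha>))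
          (prefix_sums (map (slope_excess (charge_of \<theta>) \<gamma>) \<alpha>))"
        unfolding sign_refines_def prefix_sums_map[OF pairing_weight_sum_list[OF B]]
          prefix_sums_map[OF slope_excess_sum_list[OF central_charge_charge_of]]
        by (simp add: list.rel_map list_all2_same)
    qed
  qed
qed

text \<open>Each pair of vectors that are not proportional excludes the stability parameters in one hyperplane,
  and countably many hyperplanes do not cover an open set.\<close>

lemma frequently_generic: "\<exists>\<^sub>F \<theta> in nhds (\<theta>0 :: real ^ 'r::finite). generic (charge_of \<theta>)"
proof -
  define h :: "nat ^ 'r \<Rightarrow> nat ^ 'r \<Rightarrow> real ^ 'r" where
    "h a b = (\<chi> k. of_nat (a $ k) * of_nat (vtotal b) - of_nat (b $ k) * of_nat (vtotal a))" for a b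
  \<comment> \<open>Up to the factor \<open>vtotal a * vtotal b\<close>, the inner product of \<open>h a b\<close> with \<open>\<theta>\<close> is the difference
    of the slopes of \<open>a\<close> and \<open>b\<close>.\<close>
  let ?N = "{(a, b). h a b \<noteq> 0}"
  have sub: "{\<theta>. \<not> generic (charge_of \<theta>)} \<subseteq> (\<Union>(a, b)\<in>?N. {\<theta>. h a b \<bullet> \<theta> = 0})"
  proof
    fix \<theta> :: "real ^ 'r" assume "\<theta> \<in> {\<theta>. \<not> generic (charge_of \<theta>)}"
    then obtain a b where ab: "a \<in> dimvecs" "b \<in> dimvecs" "slope (charge_of \<theta>) a = slope (charge_of \<theta>) b"
      and np: "\<not> proportional a b"
      by (auto simp: generic_def)
    have "slope (charge_of \<theta>) c = (\<Sum>k\<in>UNIV. \<theta> $ k * of_nat (c $ k)) / of_nat (vtotal c)" for c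
      by (simp add: slope_def charge_of_def to_int_vec_def vtotal_def)
    with ab(3) vtotal_pos[OF ab(1)] vtotal_pos[OF ab(2)]
    have "(\<Sum>k\<in>UNIV. \<theta> $ k * of_nat (a $ k)) * of_nat (vtotal b) =
        (\<Sum>k\<in>UNIV. \<theta> $ k * of_nat (b $ k)) * of_nat (vtotal a)"
      by (simp add: field_simps)
    then have "h a b \<bullet> \<theta> = 0"
      by (simp add: h_def inner_vec_def algebra_simps sum_subtractf sum_distrib_left)
    moreover have "h a b \<noteq> 0"
    proof
      assume "h a b = 0"
      then have "real (a $ k * vtotal b) = real (b $ k * vtotal a)" for k
        by (simp add: h_def vec_eq_iff)
      then have "a $ k * vtotal b = b $ k * vtotal a" for k by (simp only: of_nat_eq_iff)
      then have "(of_nat (a $ k) :: rat) * of_nat (vtotal b) = of_nat (b $ k) * of_nat (vtotal a)" for k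
        by (metis of_nat_mult)
      then have "\<forall>k. (of_nat (a $ k) :: rat) = of_nat (vtotal a) / of_nat (vtotal b) * of_nat (b $ k)"
        using vtotal_pos[OF ab(2)] by (simp add: field_simps)
      with np show False unfolding proportional_def by blast
    qed
    ultimately show "\<theta> \<in> (\<Union>(a, b)\<in>?N. {\<theta>. h a b \<bullet> \<theta> = 0})" by auto
  qed
  have "negligible (\<Union>((\<lambda>(a, b). {\<theta>. h a b \<bullet> \<theta> = 0}) ` ?N))"
    by (rule negligible_countable_Union) (auto intro: negligible_hyperplane)
  then have neg: "negligible {\<theta> :: real ^ 'r. \<not> generic (charge_of \<theta>)}"
    by (rule negligible_subset) (use sub in auto)
  show ?thesis
  proof (rule ccontr)
    assume "\<not> ?thesis"
    then obtain S where "open S" "\<theta>0 \<in> S" "S \<subseteq> {\<theta>. \<not> generic (charge_of \<theta>)}"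
      by (auto simp: not_frequently eventually_nhds)
    with neg negligible_subset open_not_negligible[of S] show False by blast
  qed
qed

context graded_rat_algebra begin

text \<open>All parameters close to \<open>attractor_stability B \<gamma>\<close> yield the value \<open>g_* * A\<close>. As there are
  generic ones arbitrarily close by, the defining property is satisfied by this value alone.\<close>

lemma attractor_inv_eq_act:
  assumes B: "skew_bilinear_form B"
    and comm: "\<And>\<gamma> \<gamma>' x y. B (to_int_vec \<gamma>) (to_int_vec \<gamma>') = 0 \<Longrightarrow> x \<in> R \<gamma> \<Longrightarrow> y \<in> R \<gamma>' \<Longrightarrow>
           x * y = y * x"
    and A: "\<And>\<gamma>. \<gamma> \<in> dimvecs \<Longrightarrow> A \<gamma> \<in> R \<gamma>"
    and \<gamma>: "\<gamma> \<in> dimvecs"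
  shows "attractor_inv smul B A \<gamma> = act smul (g_star B) A \<gamma>"
proof -
  let ?v = "pairing_weight B \<gamma>"
  have v: "?v (sum_list xs) = sum_list (map ?v xs)" for xs by (rule pairing_weight_sum_list[OF B])
  have v\<gamma>: "?v \<gamma> = 0" by (simp add: pairing_weight_def skew_bilinear_formD[OF B])
  have comm': "x * y = y * x" if "a + b = \<gamma>" "?v a = 0" "x \<in> R a" "y \<in> R b" for a b x y
    using comm that pairing_weight_add[OF B, of a b] by auto
  note invariant = sum_level_weight_rotation_invariant[OF v v\<gamma> _ _ _ A comm']
  let ?X = "\<Sum>bs\<in>excursion_blocks ?v \<gamma>. smul (1 / of_nat (length bs))
    (smul ((-1) ^ (length (concat bs) - 1)) (ordered_prod (map A (concat bs))))"
  have ev: "\<forall>\<^sub>F \<theta> in nhds (attractor_stability B \<gamma>). inv_bar smul A (charge_of \<theta>) \<gamma> = act smul (g_star B) A \<gamma>"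
    using eventually_sign_refines[OF B \<gamma>]
  proof eventually_elim
    case (elim \<theta>)
    let ?w = "slope_excess (charge_of \<theta>) \<gamma>"
    have Z: "central_charge (charge_of \<theta>)" by (rule central_charge_charge_of)
    have "inv_bar smul A (charge_of \<theta>) \<gamma> =
        act smul (\<lambda>\<alpha>. (-1) ^ (length \<alpha> - 1) * level_weight (map ?w \<alpha>)) A \<gamma>"
      unfolding inv_bar_eq_act[OF Z] by (rule act_cong) (simp_all add: g_Z_eq[OF Z])
    also have "\<dots> = act smul (\<lambda>\<alpha>. (-1) ^ (length \<alpha> - 1) * level_weight (map ?v \<alpha>)) A \<gamma>"
    proof (rule trans)
      show "act smul (\<lambda>\<alpha>. (-1) ^ (length \<alpha> - 1) * level_weight (map ?w \<alpha>)) A \<gamma> = ?X"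
        by (rule invariant) (use elim slope_excess_sum_list[OF Z] in simp_all)
      show "?X = act smul (\<lambda>\<alpha>. (-1) ^ (length \<alpha> - 1) * level_weight (map ?v \<alpha>)) A \<gamma>"
        by (rule invariant[symmetric]) (simp_all add: v v\<gamma> sign_refines_def list_all2_same)
    qed
    also have "\<dots> = act smul (g_star B) A \<gamma>"
      by (rule act_cong) (simp_all add: g_star_eq[OF B])
    finally show ?case .
  qed
  show ?thesis
    unfolding attractor_inv_def
  proof (rule the_equality)
    show "\<forall>\<^sub>F \<theta> in nhds (attractor_stability B \<gamma>).
        generic (charge_of \<theta>) \<longrightarrow> inv_bar smul A (charge_of \<theta>) \<gamma> = act smul (g_star B) A \<gamma>"
      using ev by eventually_elim simp
  next
    fix x assume "\<forall>\<^sub>F \<theta> in nhds (attractor_stability B \<gamma>).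
        generic (charge_of \<theta>) \<longrightarrow> inv_bar smul A (charge_of \<theta>) \<gamma> = x"
    with ev have "\<forall>\<^sub>F \<theta> in nhds (attractor_stability B \<gamma>).
        generic (charge_of \<theta>) \<longrightarrow> x = act smul (g_star B) A \<gamma>"
      by eventually_elim auto
    with frequently_generic[of "attractor_stability B \<gamma>"]
    have "\<exists>\<^sub>F \<theta> in nhds (attractor_stability B \<gamma>). x = act smul (g_star B) A \<gamma>"
      by (rule frequently_mp[rotated]) 
    then show "x = act smul (g_star B) A \<gamma>" by (simp add: frequently_const)
  qed
qed

end

section \<open>Sums over plane trees\<close>

definition tree_weight :: "('l::monoid_add list \<Rightarrow> rat) \<Rightarrow> 'l ptree \<Rightarrow> rat" where
  "tree_weight f T = prod_list (map (\<lambda>v. f (child_weights v)) (internal_vertices T))"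

definition tree_sum :: "('l::monoid_add list \<Rightarrow> rat) \<Rightarrow> 'l list \<Rightarrow> rat" where
  "tree_sum f \<alpha> = (\<Sum>T\<in>trees \<alpha>. tree_weight f T)"

lemma trees_leaves_nonempty: "T \<in> trees \<alpha> \<Longrightarrow> \<alpha> \<noteq> []"
  using leaves_nonempty by (auto simp: trees_def)

lemma Node_in_trees_iff:
  "Node ts \<in> trees \<alpha> \<longleftrightarrow>
     2 \<le> length ts \<and> concat (map leaves ts) = \<alpha> \<and> (\<forall>t\<in>set ts. t \<in> trees (leaves t))"
  by (auto simp: trees_def)

lemma length_le_concat: "[] \<notin> set bs \<Longrightarrow> length bs \<le> length (concat bs)"
proof (induction bs)
  case (Cons b bs)
  then show ?case by (cases b) auto
qed simp

lemma trees_singleton: "trees [x] = {Leaf x}"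
proof (intro equalityI subsetI)
  fix T assume T: "T \<in> trees [x]"
  show "T \<in> {Leaf x}"
  proof (cases T)
    case (Node ts)
    then have ts: "2 \<le> length ts" "concat (map leaves ts) = [x]" "\<forall>t\<in>set ts. t \<in> trees (leaves t)"
      using T by (auto simp: Node_in_trees_iff)
    then have "[] \<notin> set (map leaves ts)" using trees_leaves_nonempty by fastforce
    from length_le_concat[OF this] ts show ?thesis by simp
  qed (use T in \<open>simp add: trees_def\<close>)
qed (simp add: trees_def)

text \<open>Cutting off the root turns a tree into the list of its subtrees, and the leaves of these subtrees
  split the sequence into blocks.\<close>

lemma sum_trees:
  assumes "2 \<le> length \<alpha>"
  shows "(\<Sum>T\<in>trees \<alpha>. h T) =
    (\<Sum>bs | bs \<in> splittings \<alpha> \<and> 2 \<le> length bs. \<Sum>ts\<in>listset (map trees bs). h (Node ts))"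
proof -
  let ?S = "{bs. bs \<in> splittings \<alpha> \<and> 2 \<le> length bs}"
  have fin: "finite ?S" using finite_splittings by (rule rev_finite_subset) auto
  have "(\<Sum>bs\<in>?S. \<Sum>ts\<in>listset (map trees bs). h (Node ts)) =
      (\<Sum>(bs, ts)\<in>(SIGMA bs:?S. listset (map trees bs)). h (Node ts))"
    by (rule sum.Sigma[OF fin]) (auto simp: finite_trees intro!: finite_listset)
  also have "\<dots> = (\<Sum>T\<in>trees \<alpha>. h T)"
  proof (rule sum.reindex_bij_witness[where j = "\<lambda>(bs, ts). Node ts"
        and i = "\<lambda>T. (map leaves (children T), children T)"])
    fix x assume "x \<in> (SIGMA bs:?S. listset (map trees bs))"
    then obtain bs ts where x: "x = (bs, ts)" and bs: "bs \<in> splittings \<alpha>" "2 \<le> length bs"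
      and "ts \<in> listset (map trees bs)" by blast
    then have all2: "list_all2 (\<lambda>t b. t \<in> trees b) ts bs"
      by (simp add: in_listset_iff list.rel_map)
    then have ts: "map leaves ts = bs" "\<forall>t\<in>set ts. t \<in> trees (leaves t)"
      by (induction rule: list_all2_induct) (auto simp: trees_def)
    show "(map leaves (children (case x of (bs, ts) \<Rightarrow> Node ts)),
        children (case x of (bs, ts) \<Rightarrow> Node ts)) = x"
      by (simp add: x ts)
    show "(case x of (bs, ts) \<Rightarrow> Node ts) \<in> trees \<alpha>"
      using bs ts list_all2_lengthD[OF all2] by (simp add: x Node_in_trees_iff splittings_def)
    show "h (case x of (bs, ts) \<Rightarrow> Node ts) = (case x of (bs, ts) \<Rightarrow> h (Node ts))"
      by (simp add: x)
  next
    fix T assume T: "T \<in> trees \<alpha>"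
    obtain ts where Node: "T = Node ts"
      using T assms by (cases T) (auto simp: trees_def)
    have ts: "2 \<le> length ts" "concat (map leaves ts) = \<alpha>" "\<forall>t\<in>set ts. t \<in> trees (leaves t)"
      using T by (auto simp: Node Node_in_trees_iff)
    then have "[] \<notin> set (map leaves ts)" using trees_leaves_nonempty by fastforce
    moreover have "list_all2 (\<lambda>t b. t \<in> trees b) ts (map leaves ts)"
      using ts(3) by (simp add: list_all2_conv_all_nth)
    ultimately show "(map leaves (children T), children T) \<in> (SIGMA bs:?S. listset (map trees bs))"
      using ts by (simp add: Node splittings_def in_listset_iff list.rel_map)
    show "(case (map leaves (children T), children T) of (bs, ts) \<Rightarrow> Node ts) = T"
      by (simp add: Node)
  qed
  finally show ?thesis by simp
qed

text \<open>The weight at the root is kept separate because in \<open>F_coll\<close> the root carries a different factor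
  from the other internal vertices.\<close>

lemma sum_trees_root:
  assumes "2 \<le> length \<alpha>"
  shows "(\<Sum>T\<in>trees \<alpha>. k (child_weights T) *
      prod_list (map (\<lambda>v. f (child_weights v)) (tl (internal_vertices T)))) =
    (\<Sum>bs | bs \<in> splittings \<alpha> \<and> 2 \<le> length bs. k (map sum_list bs) * prod_list (map (tree_sum f) bs))"
  unfolding sum_trees[OF assms]
proof (intro sum.cong refl)
  fix bs assume "bs \<in> {bs. bs \<in> splittings \<alpha> \<and> 2 \<le> length bs}"
  have "k (child_weights (Node ts)) *
      prod_list (map (\<lambda>v. f (child_weights v)) (tl (internal_vertices (Node ts)))) =
      k (map sum_list bs) * prod_list (map (tree_weight f) ts)"
    if "ts \<in> listset (map trees bs)" for ts
  proof -
    have "list_all2 (\<lambda>t b. t \<in> trees b) ts bs"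
      using that by (simp add: in_listset_iff list.rel_map)
    then have "map leaves ts = bs"
      by (induction rule: list_all2_induct) (auto simp: trees_def)
    then have "child_weights (Node ts) = map sum_list bs"
      by (auto simp: child_weights_def)
    moreover have "prod_list (map g (concat (map internal_vertices ts))) =
        prod_list (map (\<lambda>t. prod_list (map g (internal_vertices t))) ts)" for g :: "'a ptree \<Rightarrow> rat"
      by (induction ts) simp_all
    ultimately show ?thesis by (simp add: tree_weight_def[abs_def])
  qed
  then show "(\<Sum>ts\<in>listset (map trees bs). k (child_weights (Node ts)) *
      prod_list (map (\<lambda>v. f (child_weights v)) (tl (internal_vertices (Node ts))))) =
      k (map sum_list bs) * prod_list (map (tree_sum f) bs)"
    by (simp add: tree_sum_def[abs_def] prod_list_sum_distrib sum_distrib_left)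
qed

lemma tree_sum_singleton: "tree_sum f [x] = 1"
  by (simp add: tree_sum_def trees_singleton tree_weight_def)

lemma tree_sum_rec:
  assumes "2 \<le> length \<alpha>"
  shows "tree_sum f \<alpha> =
    (\<Sum>bs | bs \<in> splittings \<alpha> \<and> 2 \<le> length bs. f (map sum_list bs) * prod_list (map (tree_sum f) bs))"
proof -
  have "tree_weight f T = f (child_weights T) *
      prod_list (map (\<lambda>v. f (child_weights v)) (tl (internal_vertices T)))" if "T \<in> trees \<alpha>" for T
    using that assms by (cases T) (auto simp: trees_def tree_weight_def)
  then show ?thesis
    unfolding tree_sum_def[of f \<alpha>] sum_trees_root[OF assms, symmetric] by (intro sum.cong) auto
qed

text \<open>The trivial splitting contributes the tree sum itself, and by the recursion for tree sums all the
  other splittings together contribute its negative.\<close>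

lemma comp_tree_sum:
  fixes g :: "'a::monoid_add list \<Rightarrow> rat"
  assumes g: "\<And>x. g [x] = 1" and ne: "\<alpha> \<noteq> []"
  shows "coll_comp g (tree_sum (\<lambda>\<beta>. - g \<beta>)) \<alpha> = (if length \<alpha> = 1 then 1 else 0)"
proof (cases "length \<alpha> = 1")
  case True
  then obtain x where "\<alpha> = [x]" by (auto simp: length_Suc_conv)
  then show ?thesis by (simp add: coll_comp_def splittings_singleton tree_sum_singleton g)
next
  case False
  with ne have "2 \<le> length \<alpha>" by (cases \<alpha> rule: remdups_adj.cases) auto
  then show ?thesis using False
    by (simp add: coll_comp_def sum_splittings_split_trivial[OF ne] g tree_sum_rec sum_negf)
qed

text \<open>Distributing the sign \<open>(-1) ^ (|V| - 1)\<close> over the internal vertices other than the root turns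
  their weights into \<open>-g_*\<close>, the weights occurring in the inverse of \<open>g_*\<close>.\<close>

lemma F_coll_eq_comp:
  assumes ne: "\<alpha> \<noteq> []"
  shows "F_coll B Z \<alpha> = coll_comp (g_Z Z) (tree_sum (\<lambda>\<beta>. - g_star B \<beta>)) \<alpha>"
proof (cases "length \<alpha> = 1")
  case True
  then obtain x where "\<alpha> = [x]" by (auto simp: length_Suc_conv)
  then show ?thesis
    by (simp add: coll_comp_def splittings_singleton tree_sum_singleton F_coll_def g_Z_def)
next
  case False
  with ne have len: "2 \<le> length \<alpha>" by (cases \<alpha> rule: remdups_adj.cases) auto
  let ?t = "tree_sum (\<lambda>\<beta>. - g_star B \<beta>)"
  let ?S = "{bs. bs \<in> splittings \<alpha> \<and> 2 \<le> length bs}"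
  have sgn: "prod_list (map (\<lambda>x. - f x) xs) = (-1) ^ length xs * prod_list (map f xs)"
    for f :: "'c \<Rightarrow> rat" and xs
    by (induction xs) simp_all
  have "F_coll B Z \<alpha> = (\<Sum>T\<in>trees \<alpha>. (g_Z Z (child_weights T) - g_star B (child_weights T)) *
        prod_list (map (\<lambda>v. - g_star B (child_weights v)) (tl (internal_vertices T))))"
    using False by (simp add: F_coll_def sgn mult_ac)
  also have "\<dots> = (\<Sum>bs\<in>?S. (g_Z Z (map sum_list bs) - g_star B (map sum_list bs)) *
      prod_list (map ?t bs))"
    by (rule sum_trees_root[OF len, where k = "\<lambda>\<beta>. g_Z Z \<beta> - g_star B \<beta>"])
  also have "\<dots> = (\<Sum>bs\<in>?S. g_Z Z (map sum_list bs) * prod_list (map ?t bs)) + ?t \<alpha>"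
    unfolding tree_sum_rec[OF len] by (simp add: algebra_simps sum_subtractf sum_negf)
  also have "\<dots> = coll_comp (g_Z Z) ?t \<alpha>"
    by (simp add: coll_comp_def sum_splittings_split_trivial[OF ne] g_Z_def)
  finally show ?thesis .
qed

section \<open>The attractor tree formula\<close>

context graded_rat_algebra begin

lemma act_tree_sum_attractor_inv:
  assumes B: "skew_bilinear_form B"
    and comm: "\<And>\<gamma> \<gamma>' x y. B (to_int_vec \<gamma>) (to_int_vec \<gamma>') = 0 \<Longrightarrow> x \<in> R \<gamma> \<Longrightarrow> y \<in> R \<gamma>' \<Longrightarrow>
           x * y = y * x"
    and A: "\<And>\<gamma>. \<gamma> \<in> dimvecs \<Longrightarrow> A \<gamma> \<in> R \<gamma>"
    and \<gamma>: "\<gamma> \<in> dimvecs"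
  shows "act smul (tree_sum (\<lambda>\<beta>. - g_star B \<beta>)) (attractor_inv smul B A) \<gamma> = A \<gamma>"
proof (rule act_injective[where F = "g_star B"])
  show "g_star B [a] = 1" for a by (simp add: g_star_def)
  show "act smul (g_star B) (act smul (tree_sum (\<lambda>\<beta>. - g_star B \<beta>)) (attractor_inv smul B A)) a =
      act smul (g_star B) A a" if "a \<in> dimvecs" for a
  proof -
    have "act smul (g_star B) (act smul (tree_sum (\<lambda>\<beta>. - g_star B \<beta>)) (attractor_inv smul B A)) a =
        attractor_inv smul B A a"
      unfolding act_act
      by (rule act_identity[OF that], rule comp_tree_sum) (auto simp: g_star_def decomps_def)
    also have "\<dots> = act smul (g_star B) A a"
      by (rule attractor_inv_eq_act[OF B comm A that])
    finally show ?thesis .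
  qed
qed (rule \<gamma>)

end

theorem theorem3p6:
  fixes smul :: "rat \<Rightarrow> 'a::ring \<Rightarrow> 'a"
    and R :: "nat ^ 'r::finite \<Rightarrow> 'a set"
    and B :: "int ^ 'r \<Rightarrow> int ^ 'r \<Rightarrow> int"
    and A :: "nat ^ 'r \<Rightarrow> 'a"
    and Z :: "int ^ 'r \<Rightarrow> complex"
  assumes "graded_rat_algebra smul R"
    and "skew_bilinear_form B"
    and "\<And>\<gamma> \<gamma>' x y. B (to_int_vec \<gamma>) (to_int_vec \<gamma>') = 0 \<Longrightarrow> x \<in> R \<gamma> \<Longrightarrow> y \<in> R \<gamma>' \<Longrightarrow>
           x * y = y * x"
    and "\<And>\<gamma>. \<gamma> \<in> dimvecs \<Longrightarrow> A \<gamma> \<in> R \<gamma>"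
    and "central_charge Z"
  shows "\<forall>\<gamma>\<in>dimvecs. inv_bar smul A Z \<gamma> = act smul (F_coll B Z) (attractor_inv smul B A) \<gamma>"
proof
  fix \<gamma> :: "nat ^ 'r" assume "\<gamma> \<in> dimvecs"
  interpret graded_rat_algebra smul R by fact
  let ?t = "tree_sum (\<lambda>\<beta>. - g_star B \<beta>)"
  have "inv_bar smul A Z \<gamma> = act smul (g_Z Z) A \<gamma>"
    by (rule inv_bar_eq_act) fact
  also have "\<dots> = act smul (g_Z Z) (act smul ?t (attractor_inv smul B A)) \<gamma>"
    by (rule act_cong) (simp_all add: act_tree_sum_attractor_inv[OF assms(2-4)])
  also have "\<dots> = act smul (F_coll B Z) (attractor_inv smul B A) \<gamma>"
    unfolding act_act by (rule act_cong) (simp_all add: F_coll_eq_comp decomps_def)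
  finally show "inv_bar smul A Z \<gamma> = act smul (F_coll B Z) (attractor_inv smul B A) \<gamma>" .
qed

end
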